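(* Let $n\geq 3$ be an integer, let $k\geq 3$ be an odd integer, let $G$ be a connected graph of order $n$, and let $d$ be an integer with $1\leq d < k$ and $n\equiv d \pmod 2$. (1) If ($n \geq 7$ or $n=3$ or $n=5$) and $\rho(G)\geq \rho(K_1 \vee (K_{n-2}+K_1))$, then $G$ is $k$-$d$-critical unless $G = K_1 \vee (K_{n-2}+K_1)$. (2) If $n\in\{4,6\}$ and $\rho(G)\geq \rho(K_{\frac{n}{2}} \vee \frac{n}{2}K_1)$, then $G$ is $k$-$d$-critical unless $G = K_{\frac{n}{2}} \vee \frac{n}{2}K_1$.
   Context: All graphs are finite, simple and undirected. The order of $G$ is its number of vertices. $\rho(G)$ is the largest eigenvalue of the adjacency matrix of $G$. $K_m$ is the complete graph on $m$ vertices, $G_1+G_2$ is the (vertex-disjoint) union, $mK_1$ is the graph consisting of $m$ isolated vertices, and the join $G_1\vee G_2$ is obtained from vertex-disjoint $G_1,G_2$ by adding all edges between $V(G_1)$ and $V(G_2)$. Equality of graphs means isomorphism. $E_G(v)$ is the set of edges of $G$ incident with $v$. A $k$-matching of $G$ is a function $f:E(G)\to\{0,1,\dots,k\}$ with $\sum_{e\in E_G(v)}f(e)\leq k$ for every $v\in V(G)$. For odd $k\ge 3$ and $1\le d\le k$ with $|V(G)|\equiv d\pmod 2$, $G$ is $k$-$d$-critical if for every $v\in V(G)$ there exists a $k$-matching $f$ of $G$ such that $\sum_{e\in E_G(v)}f(e)=k-d$ and $\sum_{e\in E_G(u)}f(e)=k$ for all $u\in V(G)\setminus\{v\}$. *)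

theory Defs
  imports "Jordan_Normal_Form.Spectral_Radius" "HOL-Number_Theory.Cong"
begin

record 'a ugraph =
  verts :: "'a set"
  edges :: "'a set set"

definition simple_graph :: "'a ugraph \<Rightarrow> bool" where
  "simple_graph G \<longleftrightarrow> finite (verts G) \<and> (\<forall>e\<in>edges G. e \<subseteq> verts G \<and> card e = 2)"

definition connected_graph :: "'a ugraph \<Rightarrow> bool" where
  "connected_graph G \<longleftrightarrow> verts G \<noteq> {} \<and>
     (\<forall>u\<in>verts G. \<forall>v\<in>verts G. (u, v) \<in> {(x, y). {x, y} \<in> edges G}\<^sup>*)"

definition graph_iso :: "'a ugraph \<Rightarrow> 'b ugraph \<Rightarrow> bool" where
  "graph_iso G H \<longleftrightarrow> (\<exists>h. bij_betw h (verts G) (verts H) \<and>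
     (\<forall>u\<in>verts G. \<forall>v\<in>verts G. {u, v} \<in> edges G \<longleftrightarrow> {h u, h v} \<in> edges H))"

definition complete_graph :: "nat \<Rightarrow> nat ugraph" where
  "complete_graph m = \<lparr>verts = {..<m}, edges = {e. e \<subseteq> {..<m} \<and> card e = 2}\<rparr>"

definition edgeless_graph :: "nat \<Rightarrow> nat ugraph" where
  "edgeless_graph m = \<lparr>verts = {..<m}, edges = {}\<rparr>"

text \<open>Union and join are formed on the sum type, which makes the two vertex sets disjoint.\<close>

definition graph_union :: "'a ugraph \<Rightarrow> 'b ugraph \<Rightarrow> ('a + 'b) ugraph" where
  "graph_union G H =
     \<lparr>verts = verts G <+> verts H,
      edges = (\<lambda>e. Inl ` e) ` edges G \<union> (\<lambda>e. Inr ` e) ` edges H\<rparr>"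

definition graph_join :: "'a ugraph \<Rightarrow> 'b ugraph \<Rightarrow> ('a + 'b) ugraph" where
  "graph_join G H =
     \<lparr>verts = verts G <+> verts H,
      edges = edges (graph_union G H) \<union> {{Inl u, Inr v} | u v. u \<in> verts G \<and> v \<in> verts H}\<rparr>"

definition adjacency_matrix :: "'a list \<Rightarrow> 'a ugraph \<Rightarrow> real mat" where
  "adjacency_matrix vs G =
     mat (length vs) (length vs) (\<lambda>(i, j). if {vs ! i, vs ! j} \<in> edges G then 1 else 0)"

text \<open>
  The rows and columns are indexed by an arbitrary enumeration of the vertices; another
  enumeration gives a permutation-similar matrix, hence the same spectrum. The matrix is real
  symmetric, so its real spectrum contains all its eigenvalues; it is finite, and nonempty
  whenever the graph has a vertex.
\<close>

definition graph_rho :: "'a ugraph \<Rightarrow> real" where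
  "graph_rho G =
     Max (spectrum (adjacency_matrix (SOME vs. distinct vs \<and> set vs = verts G) G))"

definition incident_edges :: "'a ugraph \<Rightarrow> 'a \<Rightarrow> 'a set set" where
  "incident_edges G v = {e \<in> edges G. v \<in> e}"

definition k_matching :: "nat \<Rightarrow> 'a ugraph \<Rightarrow> ('a set \<Rightarrow> nat) \<Rightarrow> bool" where
  "k_matching k G f \<longleftrightarrow>
     (\<forall>e\<in>edges G. f e \<le> k) \<and> (\<forall>v\<in>verts G. (\<Sum>e\<in>incident_edges G v. f e) \<le> k)"

text \<open>
  Intended for odd \<open>k \<ge> 3\<close>, \<open>1 \<le> d \<le> k\<close> and order congruent to \<open>d\<close> modulo 2;
  in particular the subtraction \<open>k - d\<close> is then not truncated.
\<close>

definition k_d_critical :: "nat \<Rightarrow> nat \<Rightarrow> 'a ugraph \<Rightarrow> bool" where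
  "k_d_critical k d G \<longleftrightarrow>
     (\<forall>v\<in>verts G. \<exists>f. k_matching k G f \<and>
        (\<Sum>e\<in>incident_edges G v. f e) = k - d \<and>
        (\<forall>u\<in>verts G - {v}. (\<Sum>e\<in>incident_edges G u. f e) = k))"

end

theory Submission
  imports Defs
begin

text \<open>
  Hong's inequality \<open>\<rho>\<^sup>2 \<le> 2m - n + 1\<close> forces a graph with the given spectral radius to miss at most
  \<open>n - 2\<close> of the possible edges (at most 1 and 3 for \<open>n = 4\<close> and \<open>n = 6\<close>). For such dense graphs the
  required matchings are built by hand.
  If \<open>M\<close> is a perfect matching and \<open>g\<close> a weighting with all vertex sums equal to 2 (a triangle
  together with doubled disjoint edges), then for odd \<open>n\<close> one combines \<open>(k - d)/2\<close> times \<open>g\<close> on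
  \<open>G\<close> with \<open>d\<close> times \<open>M\<close> on \<open>G - v\<close>, and for even \<open>n\<close> one combines \<open>k - d\<close> times \<open>M\<close> on \<open>G\<close> with
  \<open>d/2\<close> times \<open>g\<close> on \<open>G - v\<close>. Both \<open>M\<close> and \<open>g\<close> exist by induction, deleting two adjacent vertices
  that together meet many missing edges. This fails only if the missing edges form a
  star \<open>K\<^bsub>1,n-2\<^esub>\<close>, a single edge (\<open>n = 4\<close>), a triangle (\<open>n = 5, 6\<close>) or a \<open>K\<^sub>4\<close> (\<open>n = 8\<close>), and these cases are the
  extremal graphs or have too small a spectral radius.
\<close>

subsection \<open>Weightings of dense graphs\<close>

definition pairs :: "'a set \<Rightarrow> 'a set set" where
  "pairs X = {e. e \<subseteq> X \<and> card e = 2}"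

definition missing :: "'a set set \<Rightarrow> 'a set \<Rightarrow> 'a set set" where
  "missing E X = pairs X - E"

text \<open>Applied to \<open>missing E X\<close> this is the neighbourhood in the complement, so
  its size is the number of missing edges at \<open>v\<close>.\<close>

definition link :: "'a set set \<Rightarrow> 'a \<Rightarrow> 'a set" where
  "link F v = {w. {v, w} \<in> F}"

text \<open>The vertex sums run over all of \<open>E\<close>, while the support is confined to
  \<open>X\<close>. Weightings of \<open>G\<close> and of \<open>G - v\<close> thus live on the same
  edge set and can be added edge by edge. The value \<open>c = 1\<close> describes a perfect
  matching, \<open>c = 2\<close> a weighting with all vertex sums 2.\<close>

definition fillable :: "'a set set \<Rightarrow> 'a set \<Rightarrow> nat \<Rightarrow> bool" where
  "fillable E X c \<longleftrightarrow> (\<exists>f :: 'a set \<Rightarrow> nat. (\<forall>e. f e \<noteq> 0 \<longrightarrow> e \<in> E \<and> e \<subseteq> X) \<and>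
     (\<forall>v\<in>X. (\<Sum>e\<in>{e\<in>E. v \<in> e}. f e) = c))"

lemma finite_pairs [simp]: "finite X \<Longrightarrow> finite (pairs X)"
  by (simp add: pairs_def)

lemma finite_missing [simp]: "finite X \<Longrightarrow> finite (missing E X)"
  by (simp add: missing_def)

lemma card_pairs: "finite X \<Longrightarrow> card (pairs X) = card X choose 2"
  by (simp add: pairs_def n_subsets)

lemma pairs_iff: "{u, w} \<in> pairs X \<longleftrightarrow> u \<in> X \<and> w \<in> X \<and> u \<noteq> w"
  by (auto simp: pairs_def card_insert_if)

lemma singleton_notin_pairs [simp]: "{v} \<notin> pairs X"
  by (simp add: pairs_def)

lemma pairsE:
  assumes "e \<in> pairs X"
  obtains a b where "e = {a, b}" "a \<noteq> b" "a \<in> X" "b \<in> X"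
  using assms by (auto simp: pairs_def card_2_iff)

lemma missing_iff: "{u, w} \<in> missing E X \<longleftrightarrow> u \<in> X \<and> w \<in> X \<and> u \<noteq> w \<and> {u, w} \<notin> E"
  by (auto simp: missing_def pairs_iff)

lemma link_subset:
  assumes "F \<subseteq> pairs X"
  shows "link F v \<subseteq> X - {v}"
proof
  fix w assume "w \<in> link F v"
  then have "{v, w} \<in> pairs X" using assms by (auto simp: link_def)
  then show "w \<in> X - {v}" by (auto simp: pairs_iff)
qed

lemma finite_link: "finite X \<Longrightarrow> F \<subseteq> pairs X \<Longrightarrow> finite (link F v)"
  by (meson finite_Diff finite_subset link_subset)

lemma missing_subset: "missing E X \<subseteq> pairs X"
  by (auto simp: missing_def)

lemma missing_mono: "X \<subseteq> Y \<Longrightarrow> missing E X \<subseteq> missing E Y"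
  by (auto simp: missing_def pairs_def)

lemma link_mono: "F \<subseteq> F' \<Longrightarrow> link F v \<subseteq> link F' v"
  by (auto simp: link_def)

lemma card_incident:
  assumes "F \<subseteq> pairs X"
  shows "card {e\<in>F. v \<in> e} = card (link F v)"
proof -
  have "bij_betw (\<lambda>w. {v, w}) (link F v) {e\<in>F. v \<in> e}"
    unfolding bij_betw_def
  proof
    show "inj_on (\<lambda>w. {v, w}) (link F v)"
      by (auto simp: inj_on_def doubleton_eq_iff)
    show "(\<lambda>w. {v, w}) ` link F v = {e\<in>F. v \<in> e}"
    proof
      show "{e\<in>F. v \<in> e} \<subseteq> (\<lambda>w. {v, w}) ` link F v"
      proof
        fix e assume e: "e \<in> {e\<in>F. v \<in> e}"
        then obtain a b where "e = {a, b}" using assms by (blast elim: pairsE)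
        then have "e = {v, a} \<or> e = {v, b}" using e by auto
        then show "e \<in> (\<lambda>w. {v, w}) ` link F v" using e by (auto simp: link_def)
      qed
    qed (auto simp: link_def)
  qed
  then show ?thesis by (simp add: bij_betw_same_card)
qed

lemma handshake:
  assumes "finite X" "F \<subseteq> pairs X"
  shows "(\<Sum>v\<in>X. card (link F v)) = 2 * card F"
proof -
  have fin: "finite F" using assms finite_pairs finite_subset by blast
  have "(\<Sum>v\<in>X. card {e\<in>F. v \<in> e}) = 2 * card F"
  proof (rule sum_multicount[OF assms(1) fin], intro ballI)
    fix e assume "e \<in> F"
    then have "e \<subseteq> X" "card e = 2" using assms(2) by (auto simp: pairs_def)
    then show "card {v\<in>X. v \<in> e} = 2" by (simp add: Collect_conj_eq Int_absorb1)
  qed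
  then show ?thesis by (simp add: card_incident[OF assms(2)])
qed

lemma card_missing_remove:
  assumes "finite X"
  shows "card (missing E (X - {v})) + card (link (missing E X) v) = card (missing E X)"
proof -
  have "missing E X = missing E (X - {v}) \<union> {e\<in>missing E X. v \<in> e}"
    by (auto simp: missing_def pairs_def)
  moreover have "missing E (X - {v}) \<inter> {e\<in>missing E X. v \<in> e} = {}"
    by (auto simp: missing_def pairs_def)
  ultimately have "card (missing E X) = card (missing E (X - {v})) + card {e\<in>missing E X. v \<in> e}"
    using assms by (metis (no_types, lifting) card_Un_disjoint finite_Un finite_missing)
  then show ?thesis by (simp add: card_incident[OF missing_subset])
qed

text \<open>As \<open>u\<close> and \<open>w\<close> are adjacent, no missing edge meets both, so
  the two deletions do not count any missing edge twice.\<close>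

lemma card_missing_remove_pair:
  assumes "finite X" "u \<noteq> w" "{u, w} \<in> E"
  shows "card (missing E (X - {u, w})) + card (link (missing E X) u) + card (link (missing E X) w)
    = card (missing E X)"
proof -
  have "link (missing E (X - {u})) w = link (missing E X) w"
    using assms(2,3) by (auto simp: link_def missing_iff insert_commute)
  moreover have "X - {u, w} = X - {u} - {w}" by auto
  ultimately show ?thesis
    using card_missing_remove[of X E u] card_missing_remove[of "X - {u}" E w] assms(1) by simp
qed

section \<open>Weightings with constant vertex sum\<close>

lemma fillable_empty: "fillable E {} c"
  unfolding fillable_def by (rule exI[of _ "\<lambda>_. 0"]) simp

lemma fillable_pair:
  assumes "finite E" "fillable E (X - {u, w}) c" "{u, w} \<in> E" "u \<in> X" "w \<in> X"
  shows "fillable E X c"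
proof -
  obtain f where f: "\<And>e. f e \<noteq> 0 \<Longrightarrow> e \<in> E \<and> e \<subseteq> X - {u, w}"
    "\<And>v. v \<in> X - {u, w} \<Longrightarrow> (\<Sum>e\<in>{e\<in>E. v \<in> e}. f e) = c"
    using assms(2) unfolding fillable_def by blast
  \<comment> \<open>The old weighting vanishes on all edges meeting \<open>u\<close> or
    \<open>w\<close>, so the new weight on the edge \<open>{u, w}\<close> alone gives both ends
    their sum.\<close>
  let ?g = "f({u, w} := c)"
  have "(\<Sum>e\<in>{e\<in>E. v \<in> e}. ?g e) = c" if "v \<in> X" for v
  proof (cases "v \<in> {u, w}")
    case True
    then have "(\<Sum>e\<in>{e\<in>E. v \<in> e}. ?g e) = (\<Sum>e\<in>{e\<in>E. v \<in> e}. if e = {u, w} then c else 0)"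
      using f(1) by (intro sum.cong) auto
    also have "\<dots> = c" using assms(1,3) True by (auto simp: sum.delta)
    finally show ?thesis .
  next
    case False
    then have "(\<Sum>e\<in>{e\<in>E. v \<in> e}. ?g e) = (\<Sum>e\<in>{e\<in>E. v \<in> e}. f e)"
      by (intro sum.cong) auto
    then show ?thesis using f(2) that False by simp
  qed
  moreover have "e \<in> E \<and> e \<subseteq> X" if "?g e \<noteq> 0" for e
    using that f(1)[of e] assms(3,4,5) by (cases "e = {u, w}") auto
  ultimately show ?thesis unfolding fillable_def by blast
qed

lemma fillable_triangle:
  assumes "finite E" "card X = 3" "missing E X = {}"
  shows "fillable E X 2"
proof -
  obtain a b c where X: "X = {a, b, c}" "a \<noteq> b" "b \<noteq> c" "a \<noteq> c"
    using assms(2) by (auto simp: card_3_iff)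
  have fX: "finite X" using X by simp
  have sub: "pairs X \<subseteq> E" using assms(3) by (auto simp: missing_def)
  let ?f = "\<lambda>e. if e \<in> pairs X then 1 else 0 :: nat"
  have "(\<Sum>e\<in>{e\<in>E. v \<in> e}. ?f e) = 2" if "v \<in> X" for v
  proof -
    have "link (pairs X) v = X - {v}" using that by (auto simp: link_def pairs_iff)
    then have "card {e\<in>pairs X. v \<in> e} = 2"
      using that assms(2) fX card_incident[of "pairs X" X v] by simp
    moreover have "{e\<in>E. v \<in> e} \<inter> pairs X = {e\<in>pairs X. v \<in> e}" using sub by auto
    ultimately show ?thesis using assms(1) by (simp add: sum.If_cases)
  qed
  moreover have "e \<in> E \<and> e \<subseteq> X" if "?f e \<noteq> 0" for e
  proof -
    have "e \<in> pairs X" using that by presburger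
    then show ?thesis using sub by (auto simp: pairs_def)
  qed
  ultimately show ?thesis unfolding fillable_def by (intro exI[of _ ?f]) simp
qed

lemma not_missing_obtain:
  assumes "finite X" "u \<in> X" "card (link (missing E X) u) + 2 \<le> card X"
  obtains w where "w \<in> X" "w \<noteq> u" "{u, w} \<in> E"
proof -
  have "card (X - {u}) > card (link (missing E X) u)" using assms by simp
  then obtain w where "w \<in> X - {u}" "w \<notin> link (missing E X) u"
    by (metis assms(1) card_mono finite_link leD missing_subset subsetI)
  then show thesis using that assms(2) by (auto simp: link_def missing_iff)
qed

text \<open>A missing edge not contained in the closed complement neighbourhood of \<open>u\<close>
  has an end \<open>w\<close> outside it. Such a \<open>w\<close> is adjacent to \<open>u\<close> in
  \<open>E\<close> and meets a missing edge.\<close>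

lemma missing_outside_obtain:
  assumes "u \<in> X" "finite X" "\<not> missing E X \<subseteq> pairs (insert u (link (missing E X) u))"
  obtains w where "w \<in> X" "w \<noteq> u" "{u, w} \<in> E" "card (link (missing E X) w) > 0"
proof -
  let ?M = "missing E X"
  obtain e where e: "e \<in> ?M" "e \<notin> pairs (insert u (link ?M u))" using assms(3) by auto
  then obtain a b where ab: "e = {a, b}" "a \<noteq> b" "a \<in> X" "b \<in> X"
    using missing_subset by (metis pairsE subsetD)
  have "\<exists>w x. e = {w, x} \<and> w \<in> X \<and> w \<notin> insert u (link ?M u)"
    using e(2) ab by (auto simp: pairs_iff)
  then obtain w x where w: "e = {w, x}" "w \<in> X" "w \<notin> insert u (link ?M u)" by blast
  then have "x \<in> link ?M w" using e(1) by (simp add: link_def)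
  then have "card (link ?M w) > 0"
    using finite_link[OF assms(2) missing_subset] card_gt_0_iff by blast
  then show thesis using w assms(1) that by (auto simp: link_def missing_iff)
qed

text \<open>A vertex on two missing edges, with any neighbour, already suffices. Otherwise the
  missing edges are pairwise disjoint: with two of them, take one end of each, chosen adjacent; with
  only one, deleting an end of it removes everything.\<close>

lemma missing_reduce:
  assumes "finite X" "card (missing E X) + 2 \<le> card X" "missing E X \<noteq> {}"
  obtains u w where "u \<in> X" "w \<in> X" "u \<noteq> w" "{u, w} \<in> E"
    "card (missing E (X - {u, w})) + 2 \<le> card (missing E X) \<or> missing E (X - {u, w}) = {}"
proof -
  let ?M = "missing E X"
  note rem = card_missing_remove_pair[OF assms(1)]
  have le: "card (link ?M u) + 2 \<le> card X" for u
    using card_missing_remove[OF assms(1), of E u] assms(2) by simp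
  show thesis
  proof (cases "\<exists>u\<in>X. card (link ?M u) \<ge> 2")
    case True
    then obtain u where u: "u \<in> X" "card (link ?M u) \<ge> 2" by blast
    obtain w where w: "w \<in> X" "w \<noteq> u" "{u, w} \<in> E" using not_missing_obtain[OF assms(1) u(1) le] .
    show thesis using that[of u w] u w rem[OF w(2)[symmetric] w(3)] by auto
  next
    case False
    obtain u x where ux: "{u, x} \<in> ?M" "u \<in> X"
      using assms(3) missing_subset by (metis ex_in_conv pairsE subsetD)
    then have "x \<in> link ?M u" by (simp add: link_def)
    then have pos: "card (link ?M u) > 0"
      using finite_link[OF assms(1) missing_subset] card_gt_0_iff by blast
    then have 1: "card (link ?M u) = 1" using False ux(2) by force
    show thesis
    proof (cases "?M \<subseteq> pairs (insert u (link ?M u))")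
      case True
      have "finite (link ?M u)" using finite_link[OF assms(1) missing_subset] .
      moreover have "u \<notin> link ?M u" by (auto simp: link_def missing_iff)
      ultimately have "card (pairs (insert u (link ?M u))) = 1" "finite (insert u (link ?M u))"
        using 1 by (auto simp: card_pairs choose_two)
      then have "card ?M \<le> 1" using True by (metis card_mono finite_pairs)
      moreover obtain w where w: "w \<in> X" "w \<noteq> u" "{u, w} \<in> E"
        using not_missing_obtain[OF assms(1) ux(2) le] .
      ultimately have "card (missing E (X - {u, w})) = 0" using rem[OF w(2)[symmetric] w(3)] pos by simp
      then have "missing E (X - {u, w}) = {}" using assms(1) by simp
      then show thesis using that[of u w] w ux by auto
    next
      case F: False
      obtain w where w: "w \<in> X" "w \<noteq> u" "{u, w} \<in> E" "card (link ?M w) > 0"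
        using missing_outside_obtain[OF ux(2) assms(1) F] .
      show thesis using that[of u w] w ux pos rem[OF w(2)[symmetric] w(3)] by auto
    qed
  qed
qed

text \<open>Adjacent pairs are peeled off by \<open>missing_reduce\<close>, which preserves the
  bound because both sides drop by at least 2 or no missing edge is left. Even sets end in the empty
  set, odd ones in a triangle. The parity term makes that triangle complete, and the triangle is why
  odd sets need \<open>c = 2\<close>.\<close>

lemma fillable_few_missing:
  assumes "finite E" "finite X" "card (missing E X) + 2 + card X mod 2 \<le> card X \<or> X = {}"
    and "even (card X) \<or> c = 2"
  shows "fillable E X c"
  using assms(2-4)
proof (induction "card X" arbitrary: X rule: less_induct)
  case less
  show ?case
  proof (cases "X = {}")
    case True then show ?thesis by (simp add: fillable_empty)
  next
    case nonempty: False
    then have few: "card (missing E X) + 2 + card X mod 2 \<le> card X" using less.prems(2) by simp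
    show ?thesis
    proof (cases "card X = 3")
      case True
      then have "card (missing E X) = 0" using few by simp
      then have "missing E X = {}" using less.prems(1) by simp
      then show ?thesis using fillable_triangle[OF assms(1) True] less.prems(3) True by auto
    next
      case not3: False
      obtain u w where uw: "u \<in> X" "w \<in> X" "u \<noteq> w" "{u, w} \<in> E"
        "card (missing E (X - {u, w})) + 2 \<le> card (missing E X) \<or> missing E (X - {u, w}) = {}"
      proof (cases "missing E X = {}")
        case True
        obtain u where "u \<in> X" using nonempty by blast
        moreover from this obtain w where "w \<in> X" "w \<noteq> u" "{u, w} \<in> E"
        proof (rule not_missing_obtain[OF less.prems(1), of u E])
          show "card (link (missing E X) u) + 2 \<le> card X" using few True by (simp add: link_def)
        qed
        moreover have "missing E (X - {u, w}) = {}" using missing_mono[of "X - {u, w}" X E] True by auto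
        ultimately show thesis using that by blast
      next
        case False
        have "card (missing E X) + 2 \<le> card X" using few by linarith
        from missing_reduce[OF less.prems(1) this False] show thesis using that by metis
      qed
      have c: "card (X - {u, w}) = card X - 2" using uw(1-3) less.prems(1) by (simp add: card_Diff_subset)
      have few': "card (missing E (X - {u, w})) + 2 + card (X - {u, w}) mod 2 \<le> card (X - {u, w}) \<or>
          X - {u, w} = {}"
      proof (cases "card X = 2")
        case True
        then show ?thesis using c less.prems(1) by simp
      next
        case False
        then have 4: "card X \<ge> 4" using few not3 by linarith
        \<comment> \<open>Once no missing edge remains, this is all that the bound demands of the
          smaller set.\<close>
        have par: "2 + j mod 2 \<le> j" if "j \<ge> 2" for j :: nat using that by presburger
        have m: "(card X - 2) mod 2 = card X mod 2" using 4 by (simp add: le_mod_geq)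
        have "card (missing E (X - {u, w})) + 2 + (card X - 2) mod 2 \<le> card X - 2"
        proof (cases "missing E (X - {u, w}) = {}")
          case True
          then show ?thesis using par[of "card X - 2"] 4 by simp
        next
          case False
          then show ?thesis using uw(5) few 4 m by linarith
        qed
        then show ?thesis unfolding c by blast
      qed
      have par': "even (card (X - {u, w})) \<or> c = 2" using c few less.prems(3) by auto
      have "card (X - {u, w}) < card X" using c few by linarith
      from less.hyps[OF this _ few' par'] have "fillable E (X - {u, w}) c"
        using less.prems(1) by blast
      from fillable_pair[OF assms(1) this uw(4,1,2)] show ?thesis .
    qed
  qed
qed

lemma card_insert_link:
  assumes "finite X"
  shows "card (insert u (link (missing E X) u)) = card (link (missing E X) u) + 1"
    and "finite (insert u (link (missing E X) u))"
proof -
  have "finite (link (missing E X) u)" using finite_link[OF assms missing_subset] .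
  moreover have "u \<notin> link (missing E X) u" by (auto simp: link_def missing_iff)
  ultimately show "card (insert u (link (missing E X) u)) = card (link (missing E X) u) + 1"
    "finite (insert u (link (missing E X) u))" by auto
qed

text \<open>The inequality is exactly what makes \<open>X - {u, w}\<close> satisfy the bound of
  \<open>fillable_few_missing\<close>: the size drops by 2 and the missing edges by the two
  complement degrees.\<close>

lemma fillable_remove_pair:
  assumes "finite E" "finite X" "u \<in> X" "w \<in> X" "u \<noteq> w" "{u, w} \<in> E" "card X \<ge> 4"
    and "card (missing E X) + 4 + card X mod 2 \<le>
      card X + card (link (missing E X) u) + card (link (missing E X) w)"
    and "even (card X) \<or> c = 2"
  shows "fillable E X c"
proof -
  have c: "card (X - {u, w}) = card X - 2" using assms(2-5) by (simp add: card_Diff_subset)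
  have m: "(card X - 2) mod 2 = card X mod 2" using assms(7) by (simp add: le_mod_geq)
  have "card (missing E (X - {u, w})) + 2 + card (X - {u, w}) mod 2 \<le> card (X - {u, w})"
    unfolding c m using assms(7,8) card_missing_remove_pair[OF assms(2,5,6)] by linarith
  moreover have "even (card (X - {u, w})) \<or> c = 2" unfolding c using assms(7,9) by simp
  ultimately have "fillable E (X - {u, w}) c"
    using assms(2) by (intro fillable_few_missing[OF assms(1)]) auto
  then show ?thesis using fillable_pair[OF assms(1) _ assms(6,3,4)] by blast
qed

text \<open>
  One missing edge more than the induction tolerates: it suffices to find adjacent vertices
  meeting at least three missing edges.
\<close>

lemma fillable_one_excess:
  assumes "finite E" "finite X" "card X \<ge> 4" "card (missing E X) + 1 + card X mod 2 = card X"
    and deg: "\<And>v. v \<in> X \<Longrightarrow> card (link (missing E X) v) + 2 \<le> card X"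
    and no_triangle: "\<And>T. T \<subseteq> X \<Longrightarrow> missing E X = pairs T \<Longrightarrow> card T = 3 \<Longrightarrow> card X > 5"
    and "even (card X) \<or> c = 2"
  shows "fillable E X c"
proof -
  let ?M = "missing E X"
  \<comment> \<open>If all complement degrees were at most 1, the handshake identity would bound the
    missing edges by half of \<open>card X\<close>, too few for the assumed number.\<close>
  have "\<exists>u\<in>X. card (link ?M u) \<ge> 2"
  proof (rule ccontr)
    assume "\<not> ?thesis"
    then have "(\<Sum>v\<in>X. card (link ?M v)) \<le> (\<Sum>v\<in>X. 1)" by (intro sum_mono) force
    then have "2 * card ?M \<le> card X" using handshake[OF assms(2) missing_subset] by simp
    then show False using assms(3,4) by presburger
  qed
  then obtain u where u: "u \<in> X" "card (link ?M u) \<ge> 2" by blast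
  have "\<exists>w. w \<in> X \<and> w \<noteq> u \<and> {u, w} \<in> E \<and> card (link ?M u) + card (link ?M w) \<ge> 3"
  proof (cases "card (link ?M u) \<ge> 3")
    case True
    then show ?thesis using not_missing_obtain[OF assms(2) u(1) deg[OF u(1)]] by (metis trans_le_add1)
  next
    case False
    let ?T = "insert u (link ?M u)"
    have T: "card ?T = 3" "finite ?T" using False u(2) card_insert_link[OF assms(2), of u E] by auto
    have "\<not> ?M \<subseteq> pairs ?T"
    \<comment> \<open>Otherwise all missing edges lie on three vertices. Their number then forces
      them to be all three sides of a triangle and \<open>card X\<close> to be at most 5, which is
      excluded.\<close>
    proof
      assume sub: "?M \<subseteq> pairs ?T"
      have cp: "card (pairs ?T) = 3" using T by (simp add: card_pairs choose_two)
      then have "card ?M \<le> 3" using sub T by (metis card_mono finite_pairs)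
      then have "card X \<le> 5" "card ?M = 3" using assms(3,4) by presburger+
      moreover from this have "?M = pairs ?T" using sub cp T by (metis card_subset_eq finite_pairs)
      moreover have "?T \<subseteq> X" using u link_subset[OF missing_subset] by fast
      ultimately show False using no_triangle T by force
    qed
    then show ?thesis
      using missing_outside_obtain[OF u(1) assms(2)] u(2)
      by (metis One_nat_def Suc_leI add_mono numeral_plus_one semiring_norm(5))
  qed
  then obtain w where "w \<in> X" "w \<noteq> u" "{u, w} \<in> E" "card (link ?M u) + card (link ?M w) \<ge> 3"
    by blast
  then show ?thesis using u assms by (intro fillable_remove_pair[of E X u w]) auto
qed

text \<open>For odd \<open>card X\<close> the induction tolerates \<open>card X - 3\<close> missing
  edges, so an adjacent pair meeting four of them is needed. A vertex of complement degree at least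
  4 will do; one of degree 3 needs a partner meeting another missing edge, which can only fail for a
  missing \<open>K_4\<close> on seven vertices; otherwise two vertices of degree 2 are used.\<close>

lemma fillable_two_excess:
  assumes "finite E" "finite X" "card X \<ge> 7" "odd (card X)" "card (missing E X) + 1 = card X"
    and deg: "\<And>v. v \<in> X \<Longrightarrow> card (link (missing E X) v) + 2 \<le> card X"
    and no_K4: "\<And>T. T \<subseteq> X \<Longrightarrow> missing E X = pairs T \<Longrightarrow> card T = 4 \<Longrightarrow> card X > 7"
  shows "fillable E X 2"
proof -
  let ?M = "missing E X"
  have "\<exists>u w. u \<in> X \<and> w \<in> X \<and> w \<noteq> u \<and> {u, w} \<in> E \<and> card (link ?M u) + card (link ?M w) \<ge> 4"
  proof (cases "\<exists>u\<in>X. card (link ?M u) \<ge> 3")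
    case True
    then obtain u where u: "u \<in> X" "card (link ?M u) \<ge> 3" by blast
    show ?thesis
    proof (cases "card (link ?M u) \<ge> 4")
      case True
      then show ?thesis
        using not_missing_obtain[OF assms(2) u(1) deg[OF u(1)]] u(1) by (metis trans_le_add1)
    next
      case False
      let ?T = "insert u (link ?M u)"
      have T: "card ?T = 4" "finite ?T" using False u(2) card_insert_link[OF assms(2), of u E] by auto
      have "\<not> ?M \<subseteq> pairs ?T"
      proof
        assume sub: "?M \<subseteq> pairs ?T"
        have cp: "card (pairs ?T) = 6" using T by (simp add: card_pairs choose_two)
        then have "card ?M \<le> 6" using sub T by (metis card_mono finite_pairs)
        then have "card X = 7" "card ?M = 6" using assms(3,5) by linarith+
        moreover from this have "?M = pairs ?T" using sub cp T by (metis card_subset_eq finite_pairs)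
        moreover have "?T \<subseteq> X" using u link_subset[OF missing_subset] by fast
        ultimately show False using no_K4 T by force
      qed
      then obtain w where "w \<in> X" "w \<noteq> u" "{u, w} \<in> E" "card (link ?M w) > 0"
        using missing_outside_obtain[OF u(1) assms(2)] by metis
      then show ?thesis using u by (intro exI[of _ u] exI[of _ w]) auto
    qed
  next
    case False
    \<comment> \<open>All complement degrees are at most 2 and sum to
      \<open>2 * (card X - 1)\<close>, so at least \<open>card X - 2\<close>, hence five, of them
      equal 2. A closed complement neighbourhood of one such vertex holds only three vertices, so
      another one is adjacent to it in \<open>E\<close>.\<close>
    let ?A = "{v\<in>X. card (link ?M v) = 2}"
    have fA: "finite ?A" using assms(2) by simp
    have "(\<Sum>v\<in>X. card (link ?M v)) \<le> (\<Sum>v\<in>X. 1 + (if card (link ?M v) = 2 then 1 else 0))"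
      using False by (intro sum_mono) force
    also have "\<dots> = card X + card ?A"
      unfolding sum.distrib using assms(2) by (simp add: sum.If_cases Int_def)
    finally have "card ?A \<ge> 5" using handshake[OF assms(2) missing_subset, of E] assms(3,5) by simp
    then obtain u where u: "u \<in> ?A" by (metis card.empty ex_in_conv not_numeral_le_zero)
    have "card (insert u (link ?M u)) = 3" "finite (insert u (link ?M u))"
      using u card_insert_link[OF assms(2), of u E] by auto
    then have "card ?A \<le> 3" if "?A \<subseteq> insert u (link ?M u)" using that by (metis card_mono)
    then have "\<not> ?A \<subseteq> insert u (link ?M u)" using \<open>card ?A \<ge> 5\<close> by linarith
    then obtain w where w: "w \<in> ?A" "w \<notin> insert u (link ?M u)" by blast
    then have "{u, w} \<in> E" using u by (auto simp: link_def missing_iff)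
    then show ?thesis using u w by (intro exI[of _ u] exI[of _ w]) auto
  qed
  then obtain u w where "u \<in> X" "w \<in> X" "w \<noteq> u" "{u, w} \<in> E"
    "card (link ?M u) + card (link ?M w) \<ge> 4" by blast
  moreover have "card X mod 2 = 1" using assms(4) by presburger
  ultimately show ?thesis using assms by (intro fillable_remove_pair[of E X u w]) auto
qed

section \<open>From weightings to critical graphs\<close>

lemma simple_edges_subset: "simple_graph G \<Longrightarrow> edges G \<subseteq> pairs (verts G)"
  by (auto simp: simple_graph_def pairs_def)

lemma simple_finite:
  assumes "simple_graph G"
  shows "finite (verts G)" "finite (edges G)"
  using assms simple_edges_subset[OF assms] finite_subset[OF _ finite_pairs]
  by (auto simp: simple_graph_def)

text \<open>Every edge has an end, and the vertex sum there dominates the weight of the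
  edge.\<close>

lemma k_matchingI:
  assumes "simple_graph G" "\<And>v. v \<in> verts G \<Longrightarrow> (\<Sum>e\<in>incident_edges G v. f e) \<le> k"
  shows "k_matching k G f"
  unfolding k_matching_def
proof (intro conjI ballI assms(2))
  fix e assume e: "e \<in> edges G"
  then obtain v where v: "v \<in> e" "v \<in> verts G"
    using simple_edges_subset[OF assms(1)] by (blast elim: pairsE)
  have "f e \<le> (\<Sum>e\<in>incident_edges G v. f e)"
    using e v simple_finite(2)[OF assms(1)] by (intro member_le_sum) (auto simp: incident_edges_def)
  then show "f e \<le> k" using assms(2)[OF v(2)] by simp
qed

text \<open>The weighting of \<open>G - v\<close> contributes nothing at \<open>v\<close>, so
  \<open>a * f + b * g\<close> has sum \<open>a * c\<close> there and \<open>a * c + b * c'\<close>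
  elsewhere.\<close>

lemma k_d_critical_combine:
  assumes G: "simple_graph G"
    and "\<And>v. v \<in> verts G \<Longrightarrow> fillable (edges G) (verts G) c \<and> fillable (edges G) (verts G - {v}) c'"
    and "a * c = k - d" "a * c + b * c' = k"
  shows "k_d_critical k d G"
  unfolding k_d_critical_def
proof
  fix v assume v: "v \<in> verts G"
  have fill: "fillable (edges G) (verts G) c" "fillable (edges G) (verts G - {v}) c'"
    using assms(2) v by auto
  from fill(1) obtain f where f:
    "\<And>u. u \<in> verts G \<Longrightarrow> (\<Sum>e\<in>incident_edges G u. f e) = c"
    unfolding fillable_def incident_edges_def by blast
  from fill(2) obtain g where g: "\<And>e. g e \<noteq> 0 \<Longrightarrow> e \<subseteq> verts G - {v}"
    "\<And>u. u \<in> verts G - {v} \<Longrightarrow> (\<Sum>e\<in>incident_edges G u. g e) = c'"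
    unfolding fillable_def incident_edges_def by blast
  have gv: "(\<Sum>e\<in>incident_edges G v. g e) = 0"
    using g(1) by (intro sum.neutral) (auto simp: incident_edges_def)
  let ?h = "\<lambda>e. a * f e + b * g e"
  have h: "(\<Sum>e\<in>incident_edges G u. ?h e) =
      a * (\<Sum>e\<in>incident_edges G u. f e) + b * (\<Sum>e\<in>incident_edges G u. g e)" for u
    by (simp add: sum.distrib sum_distrib_left)
  have hv: "(\<Sum>e\<in>incident_edges G v. ?h e) = k - d"
    using h[of v] f[OF v] gv assms(3) by simp
  have hu: "(\<Sum>e\<in>incident_edges G u. ?h e) = k" if "u \<in> verts G - {v}" for u
    using h[of u] f[of u] g(2)[OF that] assms(4) that by simp
  have "k_matching k G ?h"
  proof (rule k_matchingI[OF G])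
    fix u assume "u \<in> verts G"
    then show "(\<Sum>e\<in>incident_edges G u. ?h e) \<le> k"
      using hv hu[of u] by (cases "u = v") auto
  qed
  then show "\<exists>f. k_matching k G f \<and> (\<Sum>e\<in>incident_edges G v. f e) = k - d \<and>
        (\<forall>u\<in>verts G - {v}. (\<Sum>e\<in>incident_edges G u. f e) = k)"
    using hv hu by blast
qed

text \<open>Up to \<open>card X - 1\<close> missing edges are allowed, which is an excess of at most
  one over the induction for even size and two for odd size. The degree condition rules out isolated
  vertices. In the excluded triples of \<open>exc\<close>, \<open>T\<close> is an independent set
  larger than its complement in \<open>X\<close>, so no constant positive vertex sum is
  possible.\<close>

lemma fillable_dense:
  assumes "finite E" "finite X" "even (card X) \<or> c = 2"
    and "card (missing E X) + 1 \<le> card X" "card X \<ge> 2"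
    and deg: "\<And>v. v \<in> X \<Longrightarrow> card (link (missing E X) v) + 2 \<le> card X"
    and small: "card X = 3 \<Longrightarrow> missing E X = {}" "card X = 5 \<Longrightarrow> card (missing E X) \<le> 3"
    and exc: "\<And>T. T \<subseteq> X \<Longrightarrow> missing E X = pairs T \<Longrightarrow>
      (card T, card X) \<notin> {(3, 4), (3, 5), (4, 7)}"
  shows "fillable E X c"
proof -
  let ?m = "card (missing E X)"
  have T: "card X > 5" if "T \<subseteq> X" "missing E X = pairs T" "card T = 3" "card X \<ge> 4" for T
    using exc[OF that(1,2)] that(3,4) by force
  have K: "card X > 7" if "T \<subseteq> X" "missing E X = pairs T" "card T = 4" "card X \<ge> 7" for T
    using exc[OF that(1,2)] that(3,4) by force
  consider "?m + 2 + card X mod 2 \<le> card X" | "?m + 1 + card X mod 2 = card X"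
    | "odd (card X)" "?m + 1 = card X"
    using assms(4) by (cases "even (card X)") (auto simp: odd_iff_mod_2_eq_one, linarith+)
  then show ?thesis
  proof cases
    case 1
    then show ?thesis using fillable_few_missing[OF assms(1,2) _ assms(3)] by blast
  next
    case 2
    show ?thesis
    proof (cases "card X \<ge> 4")
      case True
      show ?thesis
        by (rule fillable_one_excess[OF assms(1,2) True 2 deg _ assms(3)]) (use T True in blast)+
    next
      case False
      \<comment> \<open>Both sizes are contradictory here: the degree or smallness condition leaves
        no missing edge, but this case requires exactly one.\<close>
      then have "card X = 2 \<or> card X = 3" using assms(5) by linarith
      moreover have "?m = 0" if "card X = 2"
      proof -
        have "\<forall>v\<in>X. card (link (missing E X) v) = 0" using deg that by force
        then show ?thesis using handshake[OF assms(2) missing_subset, of E] by simp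
      qed
      ultimately show ?thesis using 2 small(1) by auto
    qed
  next
    case 3
    have "card X \<noteq> 3" "card X \<noteq> 5" using 3 small by auto
    then have "card X \<ge> 7" using 3 assms(5) by presburger
    then have "fillable E X 2"
      using K by (intro fillable_two_excess[OF assms(1,2) _ 3 deg]) blast+
    then show ?thesis using 3 assms(3) by blast
  qed
qed

text \<open>The conditions are those of \<open>fillable_dense\<close> for all \<open>G - v\<close>,
  shifted by the deleted vertex: sizes 3 and 5 become 4 and 6, and the exceptional pairs gain one in
  their second entry. They also cover the weighting of \<open>G\<close> itself.\<close>

lemma k_d_critical_dense:
  assumes G: "simple_graph G" and n: "card (verts G) = n" "n \<ge> 3"
    and few: "card (missing (edges G) (verts G)) + 2 \<le> n"
    and deg: "\<And>v. v \<in> verts G \<Longrightarrow> card (link (missing (edges G) (verts G)) v) + 3 \<le> n"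
    and small: "n = 4 \<Longrightarrow> missing (edges G) (verts G) = {}"
      "n = 6 \<Longrightarrow> card (missing (edges G) (verts G)) \<le> 3"
    and exc: "\<And>T. T \<subseteq> verts G \<Longrightarrow> missing (edges G) (verts G) = pairs T \<Longrightarrow>
      (card T, n) \<notin> {(3, 5), (3, 6), (4, 8)}"
    and "odd k" "d \<ge> 1" "d < k" "even n \<longleftrightarrow> even d"
  shows "k_d_critical k d G"
proof -
  let ?V = "verts G" and ?E = "edges G"
  let ?M = "missing ?E ?V"
  note fin = simple_finite[OF G]
  have sub: "fillable ?E (?V - {v}) c" if v: "v \<in> ?V" and c: "odd n \<or> c = 2" for v c
  proof -
    let ?X = "?V - {v}"
    have cX: "card ?X = n - 1" "finite ?X" using v n fin by auto
    have ms: "missing ?E ?X \<subseteq> ?M" by (rule missing_mono) auto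
    have mc: "card (missing ?E ?X) \<le> card ?M" using ms fin(1) by (simp add: card_mono)
    have "card (link (missing ?E ?X) u) + 2 \<le> card ?X" if "u \<in> ?X" for u
    proof -
      have "card (link (missing ?E ?X) u) \<le> card (link ?M u)"
        using link_mono[OF ms] finite_link[OF fin(1) missing_subset] by (simp add: card_mono)
      then show ?thesis using deg[of u] that cX n by simp
    qed
    moreover have "missing ?E ?X = {}" if "card ?X = 3" using small(1) that cX n ms by auto
    moreover have "card (missing ?E ?X) \<le> 3" if "card ?X = 5"
    proof -
      have "n = 6" using that cX n by linarith
      then show ?thesis using small(2) mc by linarith
    qed
    moreover have "(card T, card ?X) \<notin> {(3, 4), (3, 5), (4, 7)}"
      if T: "T \<subseteq> ?X" "missing ?E ?X = pairs T" for T
    proof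
      assume a: "(card T, card ?X) \<in> {(3, 4), (3, 5), (4, 7)}"
      then have "(card T, n) \<in> {(3, 5), (3, 6), (4, 8)}" using cX n by auto
      \<comment> \<open>In each exceptional size \<open>few\<close>, or \<open>small\<close> for
        \<open>n = 6\<close>, allows no more missing edges in \<open>G\<close> than
        \<open>pairs T\<close> has. Hence no missing edge of \<open>G\<close> meets
        \<open>v\<close>, and \<open>T\<close> violates \<open>exc\<close> for
        \<open>G\<close>.\<close>
      moreover from this have "card ?M \<le> card (pairs T)"
        using few small(2) finite_subset[OF T(1) cX(2)] by (auto simp: card_pairs choose_two)
      then have "?M = pairs T"
        using ms T(2) fin(1) by (metis card_seteq finite_missing)
      ultimately show False using exc[of T] T(1) by auto
    qed
    ultimately show ?thesis
      using c cX n few mc fin(2) by (intro fillable_dense) auto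
  qed
  have whole: "fillable ?E ?V c" if c: "even n \<or> c = 2" for c
  proof (cases "card ?M + 2 + n mod 2 \<le> n")
    case True
    then show ?thesis using c n fin by (intro fillable_few_missing) auto
  next
    case False
    then have 2: "card ?M + 1 + n mod 2 = n" "odd n" using few by (auto simp: odd_iff_mod_2_eq_one)
    have "n \<noteq> 3"
    proof
      assume "n = 3"
      then have "\<forall>v\<in>?V. card (link ?M v) = 0" using deg by force
      then have "card ?M = 0" using handshake[OF fin(1) missing_subset, of ?E] by simp
      then show False using 2 \<open>n = 3\<close> by simp
    qed
    then have "n \<ge> 5" using 2 n by presburger
    moreover have "card (link ?M v) + 2 \<le> n" if "v \<in> ?V" for v
      using deg[OF that] by simp
    moreover have "n > 5" if "T \<subseteq> ?V" "?M = pairs T" "card T = 3" for T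
      using exc[OF that(1,2)] that(3) \<open>n \<ge> 5\<close> by force
    ultimately show ?thesis using 2 c n fin by (intro fillable_one_excess) auto
  qed
  show ?thesis
  proof (cases "even n")
    case True
    \<comment> \<open>As \<open>d < k\<close>, the term \<open>k - (k - d)\<close> is
      \<open>d\<close>. It is even here, so halving is exact.\<close>
    then have "even (k - (k - d))" "k - d + (k - (k - d)) = k" using assms by auto
    then have "(k - d) * 1 + (k - (k - d)) div 2 * 2 = k" by simp
    then show ?thesis using whole[of 1] sub[of _ 2] True
      by (intro k_d_critical_combine[OF G, of 1 2 "k - d" k d "(k - (k - d)) div 2"]) auto
  next
    case False
    then have "even (k - d)" "k - d + d = k" using assms by auto
    then have "(k - d) div 2 * 2 + d * 1 = k" "(k - d) div 2 * 2 = k - d" by auto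
    then show ?thesis using whole[of 2] sub[of _ 1] False
      by (intro k_d_critical_combine[OF G, of 2 1 "(k - d) div 2" k d d]) auto
  qed
qed

subsection \<open>Spectral radius\<close>

lemma simple_link:
  assumes "simple_graph G"
  shows "link (edges G) v \<subseteq> verts G - {v}" "finite (link (edges G) v)"
  using link_subset[OF simple_edges_subset[OF assms]]
    finite_link[OF simple_finite(1)[OF assms] simple_edges_subset[OF assms]] by auto

text \<open>The enumeration identifies vectors with functions on the vertices. All later spectral
  arguments use this form, which no longer depends on \<open>vs\<close>.\<close>

lemma adjacency_eigenvalue_iff:
  assumes G: "simple_graph G" and vs: "distinct vs" "set vs = verts G"
  shows "eigenvalue (adjacency_matrix vs G) l \<longleftrightarrow>
    (\<exists>x. (\<exists>v\<in>verts G. x v \<noteq> 0) \<and> (\<forall>v\<in>verts G. (\<Sum>w\<in>link (edges G) v. x w) = l * x v))"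
proof -
  let ?n = "length vs" and ?A = "adjacency_matrix vs G"
  have bij: "bij_betw ((!) vs) {..<?n} (verts G)" using vs by (intro bij_betw_nth) auto
  have A: "?A \<in> carrier_mat ?n ?n" by (simp add: adjacency_matrix_def)
  have mult: "(?A *\<^sub>v vec ?n (\<lambda>j. x (vs ! j))) $ i = (\<Sum>w\<in>link (edges G) (vs ! i). x w)"
    if "i < ?n" for x :: "'a \<Rightarrow> real" and i
  proof -
    have "(?A *\<^sub>v vec ?n (\<lambda>j. x (vs ! j))) $ i =
        (\<Sum>j<?n. if {vs ! i, vs ! j} \<in> edges G then x (vs ! j) else 0)"
      using that by (auto simp: adjacency_matrix_def scalar_prod_def lessThan_atLeast0 intro!: sum.cong)
    also have "\<dots> = (\<Sum>w\<in>verts G. if {vs ! i, w} \<in> edges G then x w else 0)"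
      using sum.reindex_bij_betw[OF bij, of "\<lambda>w. if {vs ! i, w} \<in> edges G then x w else 0"] by simp
    also have "\<dots> = (\<Sum>w\<in>link (edges G) (vs ! i). x w)"
      using simple_link(1)[OF G] simple_finite(1)[OF G]
      by (intro sum.mono_neutral_cong_right) (auto simp: link_def)
    finally show ?thesis .
  qed
  show ?thesis
  proof
    assume "eigenvalue ?A l"
    then obtain z where z: "z \<in> carrier_vec ?n" "z \<noteq> 0\<^sub>v ?n" "?A *\<^sub>v z = l \<cdot>\<^sub>v z"
      using A unfolding eigenvalue_def eigenvector_def by auto
    define x where "x v = z $ the_inv_into {..<?n} ((!) vs) v" for v
    have x: "x (vs ! i) = z $ i" if "i < ?n" for i
      using that bij by (simp add: x_def the_inv_into_f_f bij_betw_def)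
    have zx: "z = vec ?n (\<lambda>j. x (vs ! j))" using z(1) x by (intro eq_vecI) auto
    have "(\<Sum>w\<in>link (edges G) v. x w) = l * x v" if "v \<in> verts G" for v
    proof -
      have "v \<in> set vs" using that vs(2) by simp
      then obtain i where i: "i < ?n" "v = vs ! i" by (auto simp: in_set_conv_nth)
      have "(?A *\<^sub>v z) $ i = l * x (vs ! i)" unfolding z(3) x[OF i(1)] using z(1) i(1) by simp
      then have "(?A *\<^sub>v vec ?n (\<lambda>j. x (vs ! j))) $ i = l * x (vs ! i)" unfolding zx[symmetric] .
      then show ?thesis unfolding mult[OF i(1)] i(2) .
    qed
    moreover have "\<exists>v\<in>verts G. x v \<noteq> 0"
    proof (rule ccontr)
      assume "\<not> ?thesis"
      then have "x (vs ! i) = 0" if "i < ?n" for i using nth_mem[OF that] vs(2) by auto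
      then have "z = 0\<^sub>v ?n" using z(1) x by (intro eq_vecI) auto
      then show False using z by simp
    qed
    ultimately show "\<exists>x. (\<exists>v\<in>verts G. x v \<noteq> 0) \<and> (\<forall>v\<in>verts G. (\<Sum>w\<in>link (edges G) v. x w) = l * x v)"
      by blast
  next
    assume "\<exists>x. (\<exists>v\<in>verts G. x v \<noteq> 0) \<and> (\<forall>v\<in>verts G. (\<Sum>w\<in>link (edges G) v. x w) = l * x v)"
    then obtain x where x: "\<exists>v\<in>verts G. x v \<noteq> 0"
      "\<And>v. v \<in> verts G \<Longrightarrow> (\<Sum>w\<in>link (edges G) v. x w) = l * x v" by blast
    let ?z = "vec ?n (\<lambda>j. x (vs ! j))"
    obtain v where "v \<in> set vs" "x v \<noteq> 0" using x(1) vs(2) by auto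
    then obtain i where i: "i < ?n" "x (vs ! i) \<noteq> 0" by (auto simp: in_set_conv_nth)
    have "?z \<noteq> 0\<^sub>v ?n"
    proof
      assume "?z = 0\<^sub>v ?n"
      then have "?z $ i = 0\<^sub>v ?n $ i" by (rule arg_cong)
      then show False using i by simp
    qed
    moreover have "?A *\<^sub>v ?z = l \<cdot>\<^sub>v ?z"
    proof (rule eq_vecI)
      fix i assume "i < dim_vec (l \<cdot>\<^sub>v ?z)"
      then have i: "i < ?n" by simp
      then have "vs ! i \<in> verts G" unfolding vs(2)[symmetric] by (rule nth_mem)
      from x(2)[OF this] show "(?A *\<^sub>v ?z) $ i = (l \<cdot>\<^sub>v ?z) $ i"
        unfolding mult[OF i] using i by simp
    next
      show "dim_vec (?A *\<^sub>v ?z) = dim_vec (l \<cdot>\<^sub>v ?z)" by (simp add: adjacency_matrix_def)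
    qed
    ultimately show "eigenvalue ?A l"
      using A unfolding eigenvalue_def eigenvector_def by (intro exI[of _ ?z]) auto
  qed
qed

text \<open>Ensures that the maximum defining \<open>graph_rho\<close> is taken over a nonempty set.
  A complex eigenvalue exists, and comparing the Hermitian form of an eigenvector with its conjugate
  shows that it is real.\<close>

lemma real_symmetric_eigenvalue_exists:
  fixes A :: "real mat"
  assumes A: "A \<in> carrier_mat n n" and sym: "\<And>i j. i < n \<Longrightarrow> j < n \<Longrightarrow> A $$ (i, j) = A $$ (j, i)"
    and "n > 0"
  shows "\<exists>l. eigenvalue A l"
proof -
  let ?B = "map_mat complex_of_real A"
  have B: "?B \<in> carrier_mat n n" using A by simp
  obtain z where z: "eigenvalue ?B z"
    using spectrum_non_empty[OF B] assms(3) by (auto simp: spectrum_def)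
  then obtain v where v: "v \<in> carrier_vec n" "v \<noteq> 0\<^sub>v n" "?B *\<^sub>v v = z \<cdot>\<^sub>v v"
    using B unfolding eigenvalue_def eigenvector_def by auto
  have row: "(\<Sum>j<n. of_real (A $$ (i, j)) * v $ j) = z * v $ i" if "i < n" for i
  proof -
    have "(?B *\<^sub>v v) $ i = (\<Sum>j<n. of_real (A $$ (i, j)) * v $ j)"
      using that A v(1) by (auto simp: scalar_prod_def lessThan_atLeast0 intro!: sum.cong)
    then show ?thesis using v that by simp
  qed
  let ?S = "\<Sum>i<n. cnj (v $ i) * v $ i"
  have 1: "(\<Sum>i<n. \<Sum>j<n. cnj (v $ i) * (of_real (A $$ (i, j)) * v $ j)) = z * ?S"
  proof -
    have "(\<Sum>i<n. \<Sum>j<n. cnj (v $ i) * (of_real (A $$ (i, j)) * v $ j)) =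
        (\<Sum>i<n. cnj (v $ i) * (z * v $ i))"
      by (intro sum.cong) (auto simp: row[symmetric] sum_distrib_left)
    then show ?thesis by (simp add: sum_distrib_left algebra_simps)
  qed
  \<comment> \<open>Conjugation exchanges the roles of \<open>i\<close> and \<open>j\<close>;
    swapping the sums and using symmetry restores the form.\<close>
  have 2: "cnj (\<Sum>i<n. \<Sum>j<n. cnj (v $ i) * (of_real (A $$ (i, j)) * v $ j)) =
      (\<Sum>i<n. \<Sum>j<n. cnj (v $ i) * (of_real (A $$ (i, j)) * v $ j))"
    unfolding cnj_sum
    by (subst sum.swap) (intro sum.cong refl, simp add: sym)
  from 2 have "cnj (z * ?S) = z * ?S" unfolding 1 .
  moreover have "cnj ?S = ?S" by (simp add: mult.commute)
  ultimately have "cnj z * ?S = z * ?S" by (simp only: complex_cnj_mult)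
  then have "(z - cnj z) * ?S = 0" by (simp only: left_diff_distrib diff_self)
  moreover have "?S \<noteq> 0"
  proof
    assume "?S = 0"
    moreover have "?S = of_real (\<Sum>i<n. (cmod (v $ i))\<^sup>2)"
      by (simp add: complex_norm_square mult.commute del: of_real_power)
    ultimately have "(\<Sum>i<n. (cmod (v $ i))\<^sup>2) = 0" by (metis of_real_eq_0_iff)
    then have "v $ i = 0" if "i < n" for i using that by (subst (asm) sum_nonneg_eq_0_iff) auto
    then show False using v by (auto intro!: eq_vecI)
  qed
  ultimately have "z = cnj z" by (metis mult_eq_0_iff eq_iff_diff_eq_0)
  then obtain r where r: "z = of_real r" by (metis complex_cnj_cancel_iff Reals_cnj_iff Reals_cases)
  \<comment> \<open>A real root of the complexified characteristic polynomial is a root of the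
    original one.\<close>
  have "poly (char_poly ?B) z = 0" using z eigenvalue_root_char_poly[OF B] by simp
  then have "poly (char_poly A) r = 0"
    unfolding r of_real_hom.char_poly_hom[OF A] by simp
  then show ?thesis using eigenvalue_root_char_poly[OF A] by blast
qed

lemma graph_rho_enumeration:
  assumes "simple_graph G"
  obtains vs where "distinct vs" "set vs = verts G"
    "graph_rho G = Max (spectrum (adjacency_matrix vs G))"
proof -
  have "\<exists>vs. distinct vs \<and> set vs = verts G"
    using finite_distinct_list[OF simple_finite(1)[OF assms]] by blast
  from someI_ex[OF this] show thesis
    by (intro that[of "SOME vs. distinct vs \<and> set vs = verts G"]) (simp_all add: graph_rho_def)
qed

lemma graph_rho_ge_eigenvalue:
  assumes G: "simple_graph G" and "\<exists>v\<in>verts G. x v \<noteq> 0"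
    and "\<And>v. v \<in> verts G \<Longrightarrow> (\<Sum>w\<in>link (edges G) v. x w) = l * x v"
  shows "l \<le> graph_rho G"
proof -
  obtain vs where vs: "distinct vs" "set vs = verts G"
    and rho: "graph_rho G = Max (spectrum (adjacency_matrix vs G))"
    using graph_rho_enumeration[OF G] .
  have "adjacency_matrix vs G \<in> carrier_mat (length vs) (length vs)"
    by (simp add: adjacency_matrix_def)
  note fin = card_finite_spectrum(1)[OF this]
  have "eigenvalue (adjacency_matrix vs G) l"
    unfolding adjacency_eigenvalue_iff[OF G vs] by (intro exI[of _ x] conjI ballI assms)
  then have "l \<in> spectrum (adjacency_matrix vs G)" unfolding spectrum_def by (rule CollectI)
  from Max_ge[OF fin this] have "l \<le> Max (spectrum (adjacency_matrix vs G))" .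
  then show ?thesis using rho by (rule ord_le_eq_trans[OF _ sym])
qed

lemma graph_rho_eigenfunction:
  assumes G: "simple_graph G" and "verts G \<noteq> {}"
  obtains x where "\<exists>v\<in>verts G. x v \<noteq> 0"
    "\<And>v. v \<in> verts G \<Longrightarrow> (\<Sum>w\<in>link (edges G) v. x w) = graph_rho G * x v"
proof -
  obtain vs where vs: "distinct vs" "set vs = verts G"
    and rho: "graph_rho G = Max (spectrum (adjacency_matrix vs G))"
    using graph_rho_enumeration[OF G] .
  let ?A = "adjacency_matrix vs G"
  have A: "?A \<in> carrier_mat (length vs) (length vs)" by (simp add: adjacency_matrix_def)
  have "length vs > 0" using vs assms(2) by (metis length_greater_0_conv set_empty)
  then obtain r where "eigenvalue ?A r"
    using real_symmetric_eigenvalue_exists[OF A] by (auto simp: adjacency_matrix_def insert_commute)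
  then have ne: "spectrum ?A \<noteq> {}" unfolding spectrum_def by blast
  have "graph_rho G \<in> spectrum ?A"
    unfolding rho by (rule Max_in[OF card_finite_spectrum(1)[OF A] ne])
  then have "eigenvalue ?A (graph_rho G)" unfolding spectrum_def by simp
  then show thesis unfolding adjacency_eigenvalue_iff[OF G vs] using that by blast
qed

section \<open>Upper bounds for the spectral radius\<close>

lemma ratio_maximizer:
  fixes x y :: "'a \<Rightarrow> real"
  assumes "finite V" "\<exists>v\<in>V. x v \<noteq> 0" "\<And>v. v \<in> V \<Longrightarrow> y v > 0"
  obtains v t where "v \<in> V" "t > 0" "\<bar>x v\<bar> = t * y v" "\<forall>u\<in>V. \<bar>x u\<bar> \<le> t * y u"
proof -
  let ?r = "\<lambda>v. \<bar>x v\<bar> / y v"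
  let ?t = "Max (?r ` V)"
  have fin: "finite (?r ` V)" and ne: "?r ` V \<noteq> {}" using assms(1,2) by auto
  obtain v where v: "v \<in> V" "?t = ?r v" using Max_in[OF fin ne] by auto
  have le: "?r u \<le> ?t" if "u \<in> V" for u using that fin by simp
  obtain u where "u \<in> V" "x u \<noteq> 0" using assms(2) by blast
  then have "0 < ?r u" "?r u \<le> ?t" using assms(3) le by auto
  then have "?t > 0" by linarith
  moreover have "\<bar>x v\<bar> = ?t * y v" using v assms(3)[of v] by simp
  moreover have "\<bar>x u\<bar> \<le> ?t * y u" if "u \<in> V" for u
    using le[OF that] assms(3)[OF that] by (simp add: pos_divide_le_eq)
  ultimately show thesis using that v(1) by blast
qed

text \<open>Collatz-Wielandt bound: evaluate the eigenvalue equation at a vertex maximising the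
  ratio of \<open>x\<close> in absolute value to the positive test function \<open>y\<close>. The
  eigenfunction itself need not be positive.\<close>

lemma graph_rho_le_weighted:
  assumes G: "simple_graph G" and "verts G \<noteq> {}"
    and y: "\<And>v. v \<in> verts G \<Longrightarrow> y v > 0"
    and le: "\<And>v. v \<in> verts G \<Longrightarrow> (\<Sum>w\<in>link (edges G) v. y w) \<le> c * y v"
  shows "graph_rho G \<le> c"
proof -
  obtain x where x: "\<exists>v\<in>verts G. x v \<noteq> 0"
    "\<And>v. v \<in> verts G \<Longrightarrow> (\<Sum>w\<in>link (edges G) v. x w) = graph_rho G * x v"
    using graph_rho_eigenfunction[OF assms(1,2)] by blast
  obtain v t where v: "v \<in> verts G" "t > 0" "\<bar>x v\<bar> = t * y v"
    "\<forall>u\<in>verts G. \<bar>x u\<bar> \<le> t * y u"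
    using ratio_maximizer[where y = y, OF simple_finite(1)[OF G] x(1) y] by metis
  have "graph_rho G * (t * y v) \<le> \<bar>graph_rho G * x v\<bar>"
    unfolding abs_mult v(3) using v(2) y[OF v(1)] by (intro mult_right_mono) auto
  also have "\<dots> \<le> (\<Sum>w\<in>link (edges G) v. \<bar>x w\<bar>)"
    using x(2)[OF v(1)] sum_abs by metis
  also have "\<dots> \<le> (\<Sum>w\<in>link (edges G) v. t * y w)"
    using v(4) simple_link(1)[OF G] by (intro sum_mono) auto
  also have "\<dots> \<le> t * (c * y v)"
    unfolding sum_distrib_left[symmetric] using le[OF v(1)] v(2) by simp
  finally show ?thesis using v(2) y[OF v(1)] by simp
qed

text \<open>The row sums of the squared adjacency matrix are the sums of neighbour degrees. They
  bound the squared eigenvalue by applying the equation twice at a vertex where \<open>x\<close> is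
  largest in absolute value.\<close>

lemma graph_rho_sq_le:
  assumes G: "simple_graph G" and "verts G \<noteq> {}"
    and le: "\<And>v. v \<in> verts G \<Longrightarrow> (\<Sum>w\<in>link (edges G) v. real (card (link (edges G) w))) \<le> c"
  shows "(graph_rho G)\<^sup>2 \<le> c"
proof -
  let ?N = "link (edges G)" and ?r = "graph_rho G"
  obtain x where x: "\<exists>v\<in>verts G. x v \<noteq> 0"
    "\<And>v. v \<in> verts G \<Longrightarrow> (\<Sum>w\<in>?N v. x w) = ?r * x v"
    using graph_rho_eigenfunction[OF assms(1,2)] by blast
  obtain v t where v: "v \<in> verts G" "t > 0" "\<bar>x v\<bar> = t" "\<forall>u\<in>verts G. \<bar>x u\<bar> \<le> t"
    using ratio_maximizer[OF simple_finite(1)[OF G] x(1), of "\<lambda>_. 1"] by auto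
  have N: "w \<in> verts G" if "w \<in> ?N u" for u w using that simple_link(1)[OF G] by auto
  have "?r\<^sup>2 * x v = ?r * (\<Sum>w\<in>?N v. x w)" using x(2)[OF v(1)] by (simp add: power2_eq_square)
  also have "\<dots> = (\<Sum>w\<in>?N v. \<Sum>u\<in>?N w. x u)"
    unfolding sum_distrib_left using x(2) N by (intro sum.cong) auto
  finally have "?r\<^sup>2 * t = \<bar>\<Sum>w\<in>?N v. \<Sum>u\<in>?N w. x u\<bar>"
    using v(3) by (metis abs_mult abs_power2)
  also have "\<dots> \<le> (\<Sum>w\<in>?N v. \<Sum>u\<in>?N w. \<bar>x u\<bar>)"
    by (intro order.trans[OF sum_abs] sum_mono sum_abs)
  also have "\<dots> \<le> (\<Sum>w\<in>?N v. \<Sum>u\<in>?N w. t)"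
    using v(4) N by (intro sum_mono) auto
  also have "\<dots> = (\<Sum>w\<in>?N v. real (card (?N w))) * t" by (simp add: sum_distrib_right)
  also have "\<dots> \<le> c * t" using le[OF v(1)] v(2) by simp
  finally show ?thesis using v(2) by simp
qed

lemma connected_link_nonempty:
  assumes "simple_graph G" "connected_graph G" "card (verts G) \<ge> 2" "v \<in> verts G"
  shows "card (link (edges G) v) \<ge> 1"
proof -
  have "verts G \<noteq> {v}" using assms(3) by auto
  then obtain u where u: "u \<in> verts G" "u \<noteq> v" using assms(4) by blast
  then have "(v, u) \<in> {(x, y). {x, y} \<in> edges G}\<^sup>*"
    using assms(2,4) by (auto simp: connected_graph_def)
  then obtain w where "{v, w} \<in> edges G" using u by (auto elim: converse_rtranclE)
  then have "link (edges G) v \<noteq> {}" by (auto simp: link_def)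
  then show ?thesis using simple_link(2)[OF assms(1)] by (simp add: card_gt_0_iff Suc_leI)
qed

text \<open>Hong's bound, read off from the row sums of the square of the adjacency matrix.\<close>

lemma graph_rho_sq_le_edges:
  assumes G: "simple_graph G" and "connected_graph G" and "card (verts G) \<ge> 2"
  shows "(graph_rho G)\<^sup>2 + card (verts G) \<le> 2 * card (edges G) + 1"
proof -
  let ?V = "verts G" and ?N = "link (edges G)"
  note fin = simple_finite(1)[OF G]
  have ne: "?V \<noteq> {}" using assms(3) by auto
  \<comment> \<open>Split the degree sum over \<open>v\<close>, its neighbours and the rest
    \<open>?R\<close>. By connectedness each vertex of \<open>?R\<close> has degree at least 1, so
    \<open>v\<close> and \<open>?R\<close> together contribute at least
    \<open>card ?V - 1\<close>.\<close>
  have bound: "(\<Sum>w\<in>?N v. card (?N w)) + card ?V \<le> 2 * card (edges G) + 1" if v: "v \<in> ?V" for v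
  proof -
    let ?R = "?V - insert v (?N v)"
    have sub: "insert v (?N v) \<subseteq> ?V" using v simple_link(1)[OF G] by auto
    have notin: "v \<notin> ?N v" using simple_link(1)[OF G] by auto
    have "2 * card (edges G) = (\<Sum>w\<in>?V. card (?N w))"
      using handshake[OF fin simple_edges_subset[OF G]] by simp
    also have "\<dots> = (\<Sum>w\<in>?R. card (?N w)) + (\<Sum>w\<in>insert v (?N v). card (?N w))"
      using sum.subset_diff[OF sub fin] .
    also have "(\<Sum>w\<in>insert v (?N v). card (?N w)) = card (?N v) + (\<Sum>w\<in>?N v. card (?N w))"
      using notin simple_link(2)[OF G] by simp
    finally have "2 * card (edges G) =
        (\<Sum>w\<in>?R. card (?N w)) + (card (?N v) + (\<Sum>w\<in>?N v. card (?N w)))" .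
    moreover have "(\<Sum>w\<in>?R. card (?N w)) \<ge> (\<Sum>w\<in>?R. 1)"
      using connected_link_nonempty[OF assms] by (intro sum_mono) auto
    moreover have "card ?R = card ?V - (card (?N v) + 1)"
      using sub notin simple_link(2)[OF G] by (simp add: card_Diff_subset)
    ultimately show ?thesis by simp
  qed
  have "(\<Sum>w\<in>?N v. real (card (?N w))) \<le> real (2 * card (edges G) + 1) - real (card ?V)"
    if "v \<in> ?V" for v
  proof -
    have "real ((\<Sum>w\<in>?N v. card (?N w)) + card ?V) \<le> real (2 * card (edges G) + 1)"
      using bound[OF that] by (simp only: of_nat_le_iff)
    then show ?thesis unfolding of_nat_add[of _ "card ?V"] of_nat_sum by linarith
  qed
  then have "(graph_rho G)\<^sup>2 \<le> real (2 * card (edges G) + 1) - real (card ?V)"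
    by (rule graph_rho_sq_le[OF G ne])
  then show ?thesis by simp
qed

lemma card_edges_missing:
  assumes "simple_graph G"
  shows "card (edges G) + card (missing (edges G) (verts G)) = card (verts G) choose 2"
  using simple_edges_subset[OF assms] simple_finite[OF assms]
  by (simp add: missing_def card_Diff_subset card_pairs[symmetric] card_mono)

lemma simple_no_loop: "simple_graph G \<Longrightarrow> {v} \<notin> edges G"
  by (auto simp: simple_graph_def)

lemma edge_iff_not_missing:
  assumes "simple_graph G"
  shows "{u, v} \<in> edges G \<longleftrightarrow>
    u \<in> verts G \<and> v \<in> verts G \<and> u \<noteq> v \<and> {u, v} \<notin> missing (edges G) (verts G)"
  using simple_edges_subset[OF assms] by (auto simp: missing_iff pairs_iff dest!: subsetD)

text \<open>The test vector is 2 on the independent set \<open>T\<close> and 3 elsewhere.\<close>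

lemma graph_rho_independent_le:
  assumes G: "simple_graph G" and T: "T \<subseteq> verts G" "missing (edges G) (verts G) = pairs T"
    and "verts G \<noteq> {}"
    and c: "3 * (card (verts G) - card T) \<le> 2 * c"
      "2 * card T + 3 * (card (verts G) - card T - 1) \<le> 3 * c"
  shows "graph_rho G \<le> c"
proof (rule graph_rho_le_weighted[OF G assms(4)])
  let ?y = "\<lambda>v. if v \<in> T then 2 else 3 :: real"
  let ?V = "verts G"
  note fin = simple_finite(1)[OF G]
  have fT: "finite T" using fin T finite_subset by blast
  fix v assume v: "v \<in> ?V"
  show "?y v > 0" by simp
  show "(\<Sum>w\<in>link (edges G) v. ?y w) \<le> real c * ?y v"
  proof (cases "v \<in> T")
    case True
    then have "link (edges G) v = ?V - T"
      using T v by (auto simp: link_def edge_iff_not_missing[OF G] pairs_iff)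
    then have "(\<Sum>w\<in>link (edges G) v. ?y w) = real (3 * (card ?V - card T))"
      using fT T by (simp add: card_Diff_subset)
    also have "\<dots> \<le> real (2 * c)" using c(1) by (simp only: of_nat_le_iff)
    finally show ?thesis using True by simp
  next
    case False
    then have "link (edges G) v = T \<union> (?V - T - {v})"
      using T v by (auto simp: link_def edge_iff_not_missing[OF G] pairs_iff)
    moreover have "(\<Sum>w\<in>T \<union> (?V - T - {v}). ?y w) = (\<Sum>w\<in>T. ?y w) + (\<Sum>w\<in>?V - T - {v}. ?y w)"
      using fT fin by (intro sum.union_disjoint) auto
    ultimately have "(\<Sum>w\<in>link (edges G) v. ?y w) = (\<Sum>w\<in>T. ?y w) + (\<Sum>w\<in>?V - T - {v}. ?y w)"
      by presburger
    also have "\<dots> = real (2 * card T + 3 * (card ?V - card T - 1))"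
      using fT T v False fin by (simp add: card_Diff_subset)
    also have "\<dots> \<le> real (3 * c)" using c(2) by (simp only: of_nat_le_iff)
    finally show ?thesis using False by simp
  qed
qed

section \<open>Joins and unions, and the spectral radii of the extremal graphs\<close>

lemma image_Inl_mem: "{Inl a, Inl b} \<in> (`) Inl ` F \<longleftrightarrow> {a, b} \<in> F"
  and image_Inr_mem: "{Inr a, Inr b} \<in> (`) Inr ` F' \<longleftrightarrow> {a, b} \<in> F'"
proof -
  have l: "{Inl a, Inl b} = Inl ` e \<longleftrightarrow> {a, b} = e" for e
    using inj_image_eq_iff[OF inj_Inl, of "{a, b}" e] by simp
  show "{Inl a, Inl b} \<in> (`) Inl ` F \<longleftrightarrow> {a, b} \<in> F" unfolding image_iff l by simp
  have r: "{Inr a, Inr b} = Inr ` e \<longleftrightarrow> {a, b} = e" for e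
    using inj_image_eq_iff[OF inj_Inr, of "{a, b}" e] by simp
  show "{Inr a, Inr b} \<in> (`) Inr ` F' \<longleftrightarrow> {a, b} \<in> F'" unfolding image_iff r by simp
qed

lemma graph_union_edges [simp]:
  "{Inl a, Inl b} \<in> edges (graph_union G H) \<longleftrightarrow> {a, b} \<in> edges G"
  "{Inr c, Inr d} \<in> edges (graph_union G H) \<longleftrightarrow> {c, d} \<in> edges H"
  "{Inl a, Inr d} \<notin> edges (graph_union G H)"
  "{Inr d, Inl a} \<notin> edges (graph_union G H)"
  by (auto simp: graph_union_def image_Inl_mem image_Inr_mem)

lemma graph_join_edges [simp]:
  "{Inl a, Inl b} \<in> edges (graph_join G H) \<longleftrightarrow> {a, b} \<in> edges G"
  "{Inr c, Inr d} \<in> edges (graph_join G H) \<longleftrightarrow> {c, d} \<in> edges H"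
  "{Inl a, Inr d} \<in> edges (graph_join G H) \<longleftrightarrow> a \<in> verts G \<and> d \<in> verts H"
  "{Inr d, Inl a} \<in> edges (graph_join G H) \<longleftrightarrow> a \<in> verts G \<and> d \<in> verts H"
  by (auto simp: graph_join_def doubleton_eq_iff)

lemma graph_verts [simp]:
  "verts (graph_union G H) = verts G <+> verts H"
  "verts (graph_join G H) = verts G <+> verts H"
  "verts (complete_graph m) = {..<m}"
  "verts (edgeless_graph m) = {..<m}"
  by (simp_all add: graph_union_def graph_join_def complete_graph_def edgeless_graph_def)

lemma edge_complete_graph [simp]: "{a, b} \<in> edges (complete_graph m) \<longleftrightarrow> a < m \<and> b < m \<and> a \<noteq> b"
  by (auto simp: complete_graph_def card_insert_if)

lemma edges_edgeless_graph [simp]: "edges (edgeless_graph m) = {}"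
  by (simp add: edgeless_graph_def)

lemma simple_complete_graph: "simple_graph (complete_graph m)"
  by (simp add: simple_graph_def complete_graph_def)

lemma simple_edgeless_graph: "simple_graph (edgeless_graph m)"
  by (simp add: simple_graph_def)

lemma simple_graph_union: "simple_graph G \<Longrightarrow> simple_graph H \<Longrightarrow> simple_graph (graph_union G H)"
  by (fastforce simp: simple_graph_def graph_union_def card_image)

lemma simple_graph_join:
  assumes "simple_graph G" "simple_graph H"
  shows "simple_graph (graph_join G H)"
  using simple_graph_union[OF assms]
  by (auto simp: simple_graph_def graph_join_def)

lemma Plus_iff [simp]: "Inl a \<in> A <+> B \<longleftrightarrow> a \<in> A" "Inr b \<in> A <+> B \<longleftrightarrow> b \<in> B"
  by auto

lemma link_graph_join:
  "a \<in> verts G \<Longrightarrow> link (edges (graph_join G H)) (Inl a) = link (edges G) a <+> verts H"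
  "c \<in> verts H \<Longrightarrow> link (edges (graph_join G H)) (Inr c) = verts G <+> link (edges H) c"
  by (auto simp: link_def set_eq_iff split_sum_all)

lemma link_graph_union:
  "link (edges (graph_union G H)) (Inl a) = link (edges G) a <+> {}"
  "link (edges (graph_union G H)) (Inr c) = {} <+> link (edges H) c"
  by (auto simp: link_def set_eq_iff split_sum_all)

lemma link_complete_graph: "a < m \<Longrightarrow> link (edges (complete_graph m)) a = {..<m} - {a}"
  by (auto simp: link_def)

lemma link_empty: "link {} a = {}"
  by (simp add: link_def)

lemmas link_simps = link_graph_join link_graph_union link_complete_graph link_empty

text \<open>
  \<open>?p\<close> below is the characteristic polynomial of the quotient matrix for the three vertex classes
  (centre, clique, pendant vertex), and \<open>x\<close> the eigenvector lifted from the quotient.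
\<close>

lemma graph_rho_pendant:
  assumes "n \<ge> 3"
  shows "graph_rho (graph_join (complete_graph 1)
    (graph_union (complete_graph (n - 2)) (complete_graph 1))) > real n - 2"
proof -
  let ?P = "graph_join (complete_graph 1) (graph_union (complete_graph (n - 2)) (complete_graph 1))"
  let ?p = "\<lambda>t :: real. (t\<^sup>2 - 1) * (t - real n + 3) - (real n - 2) * t"
  have n: "real n \<ge> 3" "real (n - 2) = n - 2" "real (n - 3) = n - 3" using assms by auto
  \<comment> \<open>The value is exactly -1, so a root of \<open>?p\<close> lies strictly above
    \<open>n - 2\<close>.\<close>
  have neg: "?p (real n - 2) < 0" by (simp add: power2_eq_square algebra_simps)
  have pos: "?p n > 0"
  proof -
    have "?p n = 2 * (real n)\<^sup>2 + 2 * n - 3" by (simp add: power2_eq_square algebra_simps)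
    then show ?thesis using n zero_le_power2[of "real n"] by linarith
  qed
  have "\<exists>t\<ge>real n - 2. t \<le> n \<and> ?p t = 0"
    using neg pos by (intro IVT') (auto intro!: continuous_intros)
  then obtain t where t: "t \<ge> real n - 2" "?p t = 0" by blast
  have t2: "t > real n - 2" using t neg by (cases "t = real n - 2") auto
  define x :: "nat + nat + nat \<Rightarrow> real" where
    "x v = (case v of Inl _ \<Rightarrow> t * (t - n + 3) | Inr (Inl _) \<Rightarrow> t | Inr (Inr _) \<Rightarrow> t - n + 3)" for v
  have simple: "simple_graph ?P"
    by (intro simple_graph_join simple_graph_union simple_complete_graph)
  have "\<exists>v\<in>verts ?P. x v \<noteq> 0"
    using t2 n by (intro bexI[of _ "Inr (Inr 0)"]) (auto simp: x_def)
  moreover have "(\<Sum>w\<in>link (edges ?P) v. x w) = t * x v" if v: "v \<in> verts ?P" for v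
  proof -
    consider "v = Inl 0" | i where "v = Inr (Inl i)" "i < n - 2" | "v = Inr (Inr 0)"
      using v by auto
    then show ?thesis
    proof cases
      \<comment> \<open>At the centre the eigenvalue equation is \<open>?p t = 0\<close>; in the
        other two classes it holds identically in \<open>t\<close>.\<close>
      case 1
      then show ?thesis using t(2) n
        by (simp add: link_simps sum.Plus x_def power2_eq_square algebra_simps)
    next
      case 2
      then show ?thesis using n
        by (simp add: link_simps sum.Plus x_def algebra_simps)
    next
      case 3
      then show ?thesis by (simp add: link_simps sum.Plus x_def)
    qed
  qed
  ultimately have "t \<le> graph_rho ?P" using graph_rho_ge_eigenvalue[OF simple] by blast
  then show ?thesis using t2 by linarith
qed

text \<open>The vector equal to \<open>t\<close> on the clique and \<open>m\<close> on the
  independent set is an eigenvector. The quadratic is its equation at a clique vertex, and the one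
  at an independent vertex is an identity.\<close>

lemma graph_rho_split_ge:
  assumes "m \<ge> 1" "t\<^sup>2 = (real m - 1) * t + (real m)\<^sup>2"
  shows "t \<le> graph_rho (graph_join (complete_graph m) (edgeless_graph m))"
proof -
  let ?P = "graph_join (complete_graph m) (edgeless_graph m)"
  define x :: "nat + nat \<Rightarrow> real" where "x v = (case v of Inl _ \<Rightarrow> t | Inr _ \<Rightarrow> m)" for v
  have simple: "simple_graph ?P"
    by (intro simple_graph_join simple_edgeless_graph simple_complete_graph)
  have "\<exists>v\<in>verts ?P. x v \<noteq> 0"
    using assms by (intro bexI[of _ "Inr 0"]) (auto simp: x_def)
  moreover have "(\<Sum>w\<in>link (edges ?P) v. x w) = t * x v" if v: "v \<in> verts ?P" for v
  proof -
    consider i where "v = Inl i" "i < m" | i where "v = Inr i" "i < m"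
      using v by auto
    then show ?thesis
      using assms by cases (simp_all add: link_simps sum.Plus x_def power2_eq_square of_nat_diff algebra_simps)
  qed
  ultimately show ?thesis using graph_rho_ge_eigenvalue[OF simple] by blast
qed

section \<open>Recognising the extremal graphs\<close>

text \<open>Since the missing edges are exactly the pairs inside \<open>T\<close>, any bijections
  from \<open>T\<close> to the independent part and from its complement to the clique combine to an
  isomorphism.\<close>

lemma graph_iso_split:
  assumes G: "simple_graph G" and T: "T \<subseteq> verts G" "missing (edges G) (verts G) = pairs T"
    and "card T = m" "card (verts G) = 2 * m"
  shows "graph_iso G (graph_join (complete_graph m) (edgeless_graph m))"
proof -
  let ?V = "verts G"
  note fin = simple_finite(1)[OF G]
  have fT: "finite T" using fin T finite_subset by blast
  obtain g where g: "bij_betw g T {..<m}"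
    using finite_same_card_bij[OF fT, of "{..<m}"] assms(4) by auto
  have "card (?V - T) = m" using assms fT by (simp add: card_Diff_subset)
  then obtain f where f: "bij_betw f (?V - T) {..<m}"
    using finite_same_card_bij[of "?V - T" "{..<m}"] fin by auto
  define h where "h v = (if v \<in> T then Inr (g v) else Inl (f v))" for v
  have "bij_betw (\<lambda>v. Inl (f v)) (?V - T) (Inl ` {..<m})" "bij_betw (\<lambda>v. Inr (g v)) T (Inr ` {..<m})"
    using f g by (auto simp: bij_betw_def inj_on_def)
  moreover have "bij_betw h (?V - T) B \<longleftrightarrow> bij_betw (\<lambda>v. Inl (f v)) (?V - T) B" for B
    by (rule bij_betw_cong) (simp add: h_def)
  moreover have "bij_betw h T B \<longleftrightarrow> bij_betw (\<lambda>v. Inr (g v)) T B" for B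
    by (rule bij_betw_cong) (simp add: h_def)
  ultimately have "bij_betw h (?V - T) (Inl ` {..<m})" "bij_betw h T (Inr ` {..<m})" by blast+
  then have "bij_betw h ((?V - T) \<union> T) (Inl ` {..<m} \<union> Inr ` {..<m})"
    by (rule bij_betw_combine) auto
  moreover have "?V - T \<union> T = ?V" using T by auto
  ultimately have "bij_betw h ?V (verts (graph_join (complete_graph m) (edgeless_graph m)))"
    by (simp add: Plus_def)
  moreover have "{u, v} \<in> edges G \<longleftrightarrow> {h u, h v} \<in> edges (graph_join (complete_graph m) (edgeless_graph m))"
    if uv: "u \<in> ?V" "v \<in> ?V" for u v
  proof -
    have fm: "f w < m" if "w \<in> ?V" "w \<notin> T" for w using bij_betwE[OF f] that by simp
    have gm: "g w < m" if "w \<in> T" for w using bij_betwE[OF g] that by simp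
    have inj: "f u = f v \<longleftrightarrow> u = v" if "u \<notin> T" "v \<notin> T"
      using inj_on_eq_iff[OF bij_betw_imp_inj_on[OF f]] uv that by simp
    have "{u, v} \<in> edges G \<longleftrightarrow> u \<noteq> v \<and> \<not> (u \<in> T \<and> v \<in> T)"
      using uv by (auto simp: edge_iff_not_missing[OF G] T pairs_iff)
    then show ?thesis using fm gm inj uv by (auto simp: h_def)
  qed
  ultimately show ?thesis unfolding graph_iso_def by blast
qed

text \<open>At least \<open>n - 2\<close> missing edges meet \<open>p\<close> and no more exist, so
  the missing edges form a star at \<open>p\<close>. Then \<open>p\<close> has a single neighbour
  \<open>c\<close>, and all other pairs of vertices are adjacent.\<close>

lemma graph_iso_pendant:
  assumes G: "simple_graph G" and n: "card (verts G) = n" "n \<ge> 3"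
    and few: "card (missing (edges G) (verts G)) + 2 \<le> n"
    and p: "p \<in> verts G" "card (link (missing (edges G) (verts G)) p) + 3 > n"
  shows "graph_iso G (graph_join (complete_graph 1)
    (graph_union (complete_graph (n - 2)) (complete_graph 1)))"
proof -
  let ?V = "verts G" and ?M = "missing (edges G) (verts G)"
  let ?L = "link ?M p"
  note fin = simple_finite(1)[OF G]
  have inc: "card {e\<in>?M. p \<in> e} = card ?L" using card_incident[OF missing_subset] .
  have "card {e\<in>?M. p \<in> e} \<ge> card ?M" using inc p(2) few by linarith
  then have all: "{e\<in>?M. p \<in> e} = ?M" using fin by (intro card_seteq) auto
  then have cL: "card ?L = n - 2" using inc[unfolded all] p(2) few by linarith
  have Lsub: "?L \<subseteq> ?V - {p}" using link_subset[OF missing_subset] .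
  have "card (?V - {p} - ?L) = 1"
    using cL Lsub p(1) n fin finite_subset[OF Lsub] by (simp add: card_Diff_subset)
  then obtain c where c: "?V - {p} - ?L = {c}" using card_1_singletonE by blast
  have cp: "c \<noteq> p" "c \<in> ?V" using c by auto
  have L: "?L = ?V - {c, p}" using c Lsub by auto
  have edge: "{u, v} \<in> edges G \<longleftrightarrow> u \<noteq> v \<and> (p \<in> {u, v} \<longrightarrow> c \<in> {u, v})"
    if uv: "u \<in> ?V" "v \<in> ?V" for u v
  proof -
    have M: "{p, w} \<in> ?M \<longleftrightarrow> w \<in> ?V - {c, p}" for w using L by (auto simp: link_def)
    have pM: "p \<in> e" if "e \<in> ?M" for e using that all by blast
    consider "u = p" | "v = p" | "u \<noteq> p" "v \<noteq> p" by blast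
    then show ?thesis
    proof cases
      case 1
      then show ?thesis using uv cp by (auto simp: edge_iff_not_missing[OF G] M)
    next
      case 2
      then show ?thesis
        using uv cp unfolding insert_commute[of u v] by (auto simp: edge_iff_not_missing[OF G] M)
    next
      case 3
      then have "{u, v} \<notin> ?M" using pM[of "{u, v}"] by blast
      then show ?thesis using 3 uv by (auto simp: edge_iff_not_missing[OF G])
    qed
  qed
  have "card (?V - {c, p}) = card {..<n - 2}" unfolding L[symmetric] cL by simp
  then obtain f where f: "bij_betw f (?V - {c, p}) {..<n - 2}"
    using finite_same_card_bij[of "?V - {c, p}" "{..<n - 2}"] finite_Diff[OF fin] finite_lessThan
    by metis
  define h :: "'a \<Rightarrow> nat + nat + nat" where
    "h v = (if v = c then Inl 0 else if v = p then Inr (Inr 0) else Inr (Inl (f v)))" for v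
  let ?emb = "\<lambda>i :: nat. Inr (Inl i) :: nat + nat + nat"
  have "bij_betw (?emb \<circ> f) (?V - {c, p}) (?emb ` {..<n - 2})"
    by (intro bij_betw_trans[OF f] inj_on_imp_bij_betw) (simp add: inj_on_def)
  moreover have "bij_betw h (?V - {c, p}) B \<longleftrightarrow> bij_betw (?emb \<circ> f) (?V - {c, p}) B" for B
    by (rule bij_betw_cong) (simp add: h_def)
  ultimately have "bij_betw h (?V - {c, p}) (?emb ` {..<n - 2})" by blast
  moreover have "bij_betw h {c, p} {Inl 0, Inr (Inr 0)}"
    using cp by (auto simp: bij_betw_def h_def)
  ultimately have "bij_betw h ((?V - {c, p}) \<union> {c, p})
      ((\<lambda>i. Inr (Inl i)) ` {..<n - 2} \<union> {Inl 0, Inr (Inr 0)})"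
    by (rule bij_betw_combine) auto
  moreover have "(?V - {c, p}) \<union> {c, p} = ?V" using cp p by auto
  moreover have "(\<lambda>i. Inr (Inl i)) ` {..<n - 2} \<union> {Inl 0, Inr (Inr 0)} =
      verts (graph_join (complete_graph 1) (graph_union (complete_graph (n - 2)) (complete_graph 1)))"
    by (auto simp: Plus_def)
  ultimately have "bij_betw h ?V
      (verts (graph_join (complete_graph 1) (graph_union (complete_graph (n - 2)) (complete_graph 1))))"
    by simp
  moreover have "{u, v} \<in> edges G \<longleftrightarrow> {h u, h v} \<in> edges (graph_join (complete_graph 1)
      (graph_union (complete_graph (n - 2)) (complete_graph 1)))"
    if uv: "u \<in> ?V" "v \<in> ?V" for u v
  proof -
    have fm: "f w < n - 2" if "w \<in> ?V" "w \<noteq> c" "w \<noteq> p" for w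
      using bij_betwE[OF f] that by simp
    have inj: "f u = f v \<longleftrightarrow> u = v" if "u \<notin> {c, p}" "v \<notin> {c, p}"
      using inj_on_eq_iff[OF bij_betw_imp_inj_on[OF f]] uv that by simp
    \<comment> \<open>These settle the cases \<open>u = v\<close>, where neither side has a
      loop.\<close>
    note loop = simple_no_loop[OF G] simple_no_loop[OF simple_graph_join[OF simple_complete_graph
          simple_graph_union[OF simple_complete_graph simple_complete_graph]]]
    show ?thesis using fm inj uv cp loop
      by (cases "u = c"; cases "u = p"; cases "v = c"; cases "v = p") (auto simp: h_def edge)
  qed
  ultimately show ?thesis unfolding graph_iso_def by blast
qed

subsection \<open>The two spectral conditions\<close>

text \<open>Doubling clears the division in the binomial coefficient, and the real form combines
  directly with Hong's bound.\<close>

lemma twice_edges_plus_missing: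
  assumes "simple_graph G"
  shows "2 * real (card (edges G)) + 2 * real (card (missing (edges G) (verts G))) =
    real (card (verts G)) * (real (card (verts G)) - 1)"
proof -
  let ?n = "card (verts G)"
  have "even (?n * (?n - 1))" by (cases "even ?n") auto
  then have "2 * (?n choose 2) = ?n * (?n - 1)" unfolding choose_two by (rule dvd_mult_div_cancel)
  then have "2 * card (edges G) + 2 * card (missing (edges G) (verts G)) = ?n * (?n - 1)"
    using card_edges_missing[OF assms] by simp
  then have "real (2 * card (edges G) + 2 * card (missing (edges G) (verts G))) = real (?n * (?n - 1))"
    by (rule arg_cong)
  then show ?thesis by (cases ?n) (auto simp: algebra_simps)
qed

text \<open>The strict bound \<open>graph_rho G > n - 2\<close> and Hong's inequality leave at most
  \<open>n - 2\<close> missing edges. A vertex on \<open>n - 2\<close> of them would make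
  \<open>G\<close> the excluded graph. The exceptional shapes with \<open>n = 5\<close> and
  \<open>n = 8\<close> have spectral radius at most \<open>n - 2\<close>.\<close>

lemma k_d_critical_of_rho_pendant:
  assumes G: "simple_graph G" "connected_graph G" and n: "card (verts G) = n" "n \<ge> 3" "n \<notin> {4, 6}"
    and kd: "odd k" "d \<ge> 1" "d < k" "even n \<longleftrightarrow> even d"
    and rho: "graph_rho G \<ge> graph_rho (graph_join (complete_graph 1)
          (graph_union (complete_graph (n - 2)) (complete_graph 1)))"
    and not_iso: "\<not> graph_iso G (graph_join (complete_graph 1)
            (graph_union (complete_graph (n - 2)) (complete_graph 1)))"
  shows "k_d_critical k d G"
proof -
  let ?M = "missing (edges G) (verts G)"
  have ne: "verts G \<noteq> {}" using n by auto
  have large: "graph_rho G > real n - 2" using graph_rho_pendant[OF n(2)] rho by linarith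
  have "(real n - 2)\<^sup>2 < (graph_rho G)\<^sup>2" using large n(2) by (intro power_strict_mono) auto
  moreover have "(graph_rho G)\<^sup>2 + real n \<le> 2 * real (card (edges G)) + 1"
    using graph_rho_sq_le_edges[OF G] n by simp
  moreover have "2 * real (card (edges G)) + 2 * real (card ?M) = real n * (real n - 1)"
    using twice_edges_plus_missing[OF G(1)] n(1) by simp
  ultimately have "2 * real (card ?M) < 2 * real n - 3"
    by (simp add: power2_eq_square algebra_simps)
  then have few: "card ?M + 2 \<le> n" by linarith
  have deg: "card (link ?M v) + 3 \<le> n" if "v \<in> verts G" for v
    using graph_iso_pendant[OF G(1) n(1,2) few that] not_iso by linarith
  have exc: "(card T, n) \<notin> {(3, 5), (3, 6), (4, 8)}" if T: "T \<subseteq> verts G" "?M = pairs T" for T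
  proof
    assume "(card T, n) \<in> {(3, 5), (3, 6), (4, 8)}"
    then consider "card T = 3" "n = 5" | "card T = 4" "n = 8" using n(3) by auto
    then show False
    proof cases
      case 1
      then have "graph_rho G \<le> real 3" using n(1) by (intro graph_rho_independent_le[OF G(1) T ne]) auto
      then show False using large 1 by simp
    next
      case 2
      then have "graph_rho G \<le> real 6" using n(1) by (intro graph_rho_independent_le[OF G(1) T ne]) auto
      then show False using large 2 by simp
    qed
  qed
  show ?thesis
    by (rule k_d_critical_dense[OF G(1) n(1,2) few deg _ _ exc kd]) (use n(3) in auto)
qed

text \<open>Hong's inequality allows at most 1 missing edge for \<open>n = 4\<close> and at most 3
  for \<open>n = 6\<close>. The shapes that would obstruct the weightings, a single missing edge and
  a missing triangle, are precisely the excluded graphs.\<close>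

lemma k_d_critical_of_rho_split:
  assumes G: "simple_graph G" "connected_graph G" and n: "card (verts G) = n" "n \<in> {4, 6}"
    and kd: "odd k" "d \<ge> 1" "d < k" "even n \<longleftrightarrow> even d"
    and rho: "graph_rho G \<ge> graph_rho (graph_join (complete_graph (n div 2)) (edgeless_graph (n div 2)))"
    and not_iso: "\<not> graph_iso G (graph_join (complete_graph (n div 2)) (edgeless_graph (n div 2)))"
  shows "k_d_critical k d G"
proof -
  let ?M = "missing (edges G) (verts G)"
  note fin = simple_finite(1)[OF G(1)]
  have hong: "(graph_rho G)\<^sup>2 + real n \<le> 2 * real (card (edges G)) + 1"
    using graph_rho_sq_le_edges[OF G] n by auto
  have total: "2 * real (card (edges G)) + 2 * real (card ?M) = real n * (real n - 1)"
    using twice_edges_plus_missing[OF G(1)] n(1) by simp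
  have not_split: "?M \<noteq> pairs T" if "T \<subseteq> verts G" "card T = n div 2" for T
    using graph_iso_split[OF G(1) that(1) _ that(2)] n not_iso by auto
  have "n = 4 \<or> n = 6" using n(2) by auto
  then show ?thesis
  proof
    assume n4: "n = 4"
    \<comment> \<open>Positive root of the quadratic in \<open>graph_rho_split_ge\<close> for
      \<open>m = 2\<close>. The estimate 5/2 suffices because its square exceeds 6.\<close>
    let ?t = "(1 + sqrt 17) / 2"
    have "?t\<^sup>2 = (real 2 - 1) * ?t + (real 2)\<^sup>2" by (simp add: power2_eq_square field_simps)
    then have "?t \<le> graph_rho (graph_join (complete_graph 2) (edgeless_graph 2))"
      by (intro graph_rho_split_ge) auto
    moreover have "sqrt 17 \<ge> 4" by (rule real_le_rsqrt) simp
    ultimately have "graph_rho G \<ge> 5 / 2" using rho n4 by simp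
    then have "(graph_rho G)\<^sup>2 \<ge> (5 / 2)\<^sup>2" by (intro power_mono) auto
    then have "(graph_rho G)\<^sup>2 > 6" by (simp add: power2_eq_square)
    then have "card ?M \<le> 1" using hong total n4 by simp
    have "?M = {}"
    proof (rule ccontr)
      assume "?M \<noteq> {}"
      then have "card ?M = 1" using \<open>card ?M \<le> 1\<close> fin by (simp add: le_Suc_eq)
      then obtain e where e: "?M = {e}" by (rule card_1_singletonE)
      moreover from this have e2: "e \<subseteq> verts G" "card e = 2" by (auto simp: missing_def pairs_def)
      moreover from this have "pairs e = {e}"
        using card_subset_eq[OF finite_subset[OF e2(1) fin]] by (auto simp: pairs_def)
      ultimately show False using not_split[of e] n4 by simp
    qed
    then show ?thesis using n n4 by (intro k_d_critical_dense[OF G(1) n(1) _ _ _ _ _ _ kd]) (auto simp: link_def)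
  next
    assume n6: "n = 6"
    \<comment> \<open>Positive root for \<open>m = 3\<close>. The bound 63/20 for the square root of
      10 is fine enough for the squared radius to exceed 17, which excludes four missing
      edges.\<close>
    let ?t = "1 + sqrt 10"
    have "?t\<^sup>2 = (real 3 - 1) * ?t + (real 3)\<^sup>2" by (simp add: power2_eq_square algebra_simps)
    then have "?t \<le> graph_rho (graph_join (complete_graph 3) (edgeless_graph 3))"
      by (intro graph_rho_split_ge) auto
    moreover have "sqrt 10 \<ge> 63 / 20" by (rule real_le_rsqrt) (simp add: power2_eq_square)
    ultimately have "graph_rho G \<ge> 83 / 20" using rho n6 by simp
    then have "(graph_rho G)\<^sup>2 \<ge> (83 / 20)\<^sup>2" by (intro power_mono) auto
    then have "(graph_rho G)\<^sup>2 > 17" by (simp add: power2_eq_square)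
    then have M3: "card ?M \<le> 3" using hong total n6 by simp
    have "card (link ?M v) + 3 \<le> n" for v
      using card_missing_remove[OF fin, of "edges G" v] M3 n6 by linarith
    moreover have "(card T, n) \<notin> {(3, 5), (3, 6), (4, 8)}" if "T \<subseteq> verts G" "?M = pairs T" for T
      using not_split[OF that(1)] that(2) n6 by auto
    ultimately show ?thesis
      using M3 n6 by (intro k_d_critical_dense[OF G(1) n(1) _ _ _ _ _ _ kd]) auto
  qed
qed

theorem theorem5p2:
  fixes G :: "'a ugraph" and n k d :: nat
  assumes "n \<ge> 3"
    and "k \<ge> 3" and "odd k"
    and "simple_graph G" and "connected_graph G" and "card (verts G) = n"
    and "1 \<le> d" and "d < k" and "[n = d] (mod 2)"
  shows
    "((n \<ge> 7 \<or> n = 3 \<or> n = 5) \<and>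
        graph_rho G \<ge> graph_rho (graph_join (complete_graph 1)
          (graph_union (complete_graph (n - 2)) (complete_graph 1)))
      \<longrightarrow> \<not> graph_iso G (graph_join (complete_graph 1)
            (graph_union (complete_graph (n - 2)) (complete_graph 1)))
      \<longrightarrow> k_d_critical k d G) \<and>
     (n \<in> {4, 6} \<and>
        graph_rho G \<ge> graph_rho (graph_join (complete_graph (n div 2)) (edgeless_graph (n div 2)))
      \<longrightarrow> \<not> graph_iso G (graph_join (complete_graph (n div 2)) (edgeless_graph (n div 2)))
      \<longrightarrow> k_d_critical k d G)"
proof -
  have par: "even n \<longleftrightarrow> even d" using assms(9) unfolding cong_def by presburger
  have "n \<ge> 7 \<or> n = 3 \<or> n = 5 \<Longrightarrow> n \<notin> {4, 6}" by auto
  then show ?thesis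
    using k_d_critical_of_rho_pendant[OF assms(4-6,1) _ assms(3,7,8) par]
      k_d_critical_of_rho_split[OF assms(4-6) _ assms(3,7,8) par] by blast
qed

end
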